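(* The following statements are equivalent for every cardinal $\kappa$: (i) $\kappa$ is ineffable. (ii) For all sufficiently large cardinals $\theta$ and for every $\kappa$-list $\vec d=\langle d_\alpha\mid\alpha<\kappa\rangle$, there is a small embedding $j:M\longrightarrow \mathrm{H}(\theta)$ for $\kappa$ with $\vec d\in\mathrm{ran}(j)$ and $d_{\mathrm{crit}(j)}\in M$.
   Context: $\mathrm{H}(\theta)$ is the set of all sets whose transitive closure has cardinality less than $\theta$. An elementary embedding $j:M\to N$ between transitive classes is non-trivial if there is an ordinal $\alpha\in M$ with $j(\alpha)>\alpha$; then $\mathrm{crit}(j)$ denotes the least such ordinal. Given cardinals $\kappa<\theta$, a non-trivial elementary embedding $j:M\to \mathrm{H}(\theta)$ is a small embedding for $\kappa$ if $M\in \mathrm{H}(\theta)$ is transitive and $j(\mathrm{crit}(j))=\kappa$. "For all sufficiently large cardinals $\theta$" means: there is an ordinal $\alpha\geq\kappa$ such that the statement holds for all cardinals $\theta>\alpha$. Given a set $A$, an $A$-list is a sequence $\langle d_a\mid a\in A\rangle$ with $d_a\subseteq a$ for all $a\in A$. A regular uncountable cardinal $\kappa$ is ineffable if for every $\kappa$-list $\langle d_\alpha\mid\alpha<\kappa\rangle$ there is a subset $D$ of $\kappa$ such that the set $\{\alpha<\kappa\mid d_\alpha=D\cap\alpha\}$ is stationary in $\kappa$. *)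

theory Defs
  imports "HOL-Library.Equipollence" "HOL-Library.Countable_Set"
begin

text \<open>
  The set-theoretic universe is a type with an element map \<open>elts\<close> satisfying the axioms of ZFC,
  where the schemes of separation and replacement range over arbitrary HOL predicates and functions.
  The axiom of choice is inherited from HOL (see \<open>zfc_choice\<close> below).
  Elements of the type are sets; subsets \<open>'v set\<close> of the type are classes.
\<close>

class zfc_universe =
  fixes elts :: "'a \<Rightarrow> 'a set"
  assumes extensionality: "elts x = elts y \<Longrightarrow> x = y"
    and foundation: "elts x \<noteq> {} \<Longrightarrow> \<exists>y\<in>elts x. elts y \<inter> elts x = {}"
    and separation: "\<exists>y. elts y = {z \<in> elts x. P z}"
    and pairing: "\<exists>z. elts z = {x, y}"
    and union: "\<exists>y. elts y = (\<Union>z\<in>elts x. elts z)"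
    and powerset: "\<exists>y. elts y = {z. elts z \<subseteq> elts x}"
    and infinity: "\<exists>x. (\<exists>e\<in>elts x. elts e = {}) \<and>
                       (\<forall>y\<in>elts x. \<exists>z\<in>elts x. elts z = insert y (elts y))"
    and replacement: "\<exists>y. elts y = f ` elts x"

lemma zfc_choice:
  fixes x :: "'v::zfc_universe"
  assumes nonempty: "\<And>y. y \<in> elts x \<Longrightarrow> elts y \<noteq> {}"
    and disjoint: "\<And>y z. y \<in> elts x \<Longrightarrow> z \<in> elts x \<Longrightarrow> y \<noteq> z \<Longrightarrow> elts y \<inter> elts z = {}"
  shows "\<exists>c::'v. \<forall>y\<in>elts x. \<exists>!z. z \<in> elts c \<and> z \<in> elts y"
proof -
  define f where "f y = (SOME z. z \<in> elts y)" for y :: 'v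
  have f: "f y \<in> elts y" if "y \<in> elts x" for y
    using nonempty[OF that] unfolding f_def by (simp add: some_in_eq)
  obtain c :: 'v where c: "elts c = f ` elts x"
    using replacement[of f x] by (elim exE)
  have "\<exists>!z. z \<in> elts c \<and> z \<in> elts y" if y: "y \<in> elts x" for y
  proof (rule ex1I[of _ "f y"])
    show "f y \<in> elts c \<and> f y \<in> elts y"
      using c f[OF y] y by simp
    show "z = f y" if z: "z \<in> elts c \<and> z \<in> elts y" for z
    proof -
      obtain w where w: "w \<in> elts x" "z = f w"
        using z c by auto
      then have "z \<in> elts w \<inter> elts y"
        using f[OF w(1)] z by simp
      then have "w = y"
        using disjoint[OF w(1) y] by auto
      then show ?thesis
        using w by simp
    qed
  qed
  then show ?thesis by (intro exI[of _ c] ballI)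
qed


subsection \<open>Sets coding classes, ordered pairs and sequences\<close>

text \<open>Only meaningful for classes \<open>A\<close> that are sets, i.e. in the range of \<open>elts\<close>.\<close>

definition set_of :: "'v::zfc_universe set \<Rightarrow> 'v" where
  "set_of A = (THE x. elts x = A)"

definition kpair :: "'v::zfc_universe \<Rightarrow> 'v \<Rightarrow> 'v" where
  "kpair a b = set_of {set_of {a}, set_of {a, b}}"

text \<open>
  By replacement, the functions with domain a set \<open>A\<close> in the sense of set theory are exactly the
  graphs over \<open>A\<close> of HOL functions. So a sequence indexed by \<open>A\<close> is represented by a HOL function
  \<open>d\<close>, of which only the values on \<open>elts A\<close> matter, and \<open>seq A d\<close> is the sequence as an
  element of the universe.
\<close>

definition seq :: "'v::zfc_universe \<Rightarrow> ('v \<Rightarrow> 'v) \<Rightarrow> 'v" where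
  "seq A d = set_of ((\<lambda>a. kpair a (d a)) ` elts A)"

definition list_on :: "'v::zfc_universe \<Rightarrow> ('v \<Rightarrow> 'v) \<Rightarrow> bool" where
  "list_on A d \<longleftrightarrow> (\<forall>a\<in>elts A. elts (d a) \<subseteq> elts a)"


subsection \<open>Ordinals and cardinals\<close>

definition transitive :: "'v::zfc_universe \<Rightarrow> bool" where
  "transitive x \<longleftrightarrow> (\<forall>y\<in>elts x. elts y \<subseteq> elts x)"

text \<open>By foundation, these are the transitive sets well-ordered by membership. For ordinals,
  \<open>\<alpha> < \<beta>\<close> is \<open>\<alpha> \<in> elts \<beta>\<close>, and \<open>\<alpha> \<le> \<beta>\<close> is \<open>elts \<alpha> \<subseteq> elts \<beta>\<close>.\<close>

definition ordinal :: "'v::zfc_universe \<Rightarrow> bool" where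
  "ordinal \<alpha> \<longleftrightarrow> transitive \<alpha> \<and> (\<forall>x\<in>elts \<alpha>. transitive x)"

definition cardinal :: "'v::zfc_universe \<Rightarrow> bool" where
  "cardinal \<kappa> \<longleftrightarrow> ordinal \<kappa> \<and> (\<forall>\<alpha>\<in>elts \<kappa>. \<not> elts \<alpha> \<approx> elts \<kappa>)"

definition regular :: "'v::zfc_universe \<Rightarrow> bool" where
  "regular \<kappa> \<longleftrightarrow> cardinal \<kappa> \<and> infinite (elts \<kappa>) \<and>
     (\<forall>\<alpha>\<in>elts \<kappa>. \<forall>f. f ` elts \<alpha> \<subseteq> elts \<kappa> \<longrightarrow> (\<exists>\<beta>\<in>elts \<kappa>. \<forall>\<xi>\<in>elts \<alpha>. f \<xi> \<in> elts \<beta>))"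

text \<open>\<open>unbounded_in C \<delta>\<close> holds for \<open>\<delta> = 0\<close> and fails for successor ordinals \<open>\<delta>\<close>.\<close>

definition unbounded_in :: "'v::zfc_universe set \<Rightarrow> 'v \<Rightarrow> bool" where
  "unbounded_in C \<delta> \<longleftrightarrow> (\<forall>\<beta>\<in>elts \<delta>. \<exists>\<gamma>\<in>C \<inter> elts \<delta>. \<beta> \<in> elts \<gamma>)"

definition club_in :: "'v::zfc_universe set \<Rightarrow> 'v \<Rightarrow> bool" where
  "club_in C \<kappa> \<longleftrightarrow> C \<subseteq> elts \<kappa> \<and> unbounded_in C \<kappa> \<and>
     (\<forall>\<delta>\<in>elts \<kappa>. elts \<delta> \<noteq> {} \<and> unbounded_in C \<delta> \<longrightarrow> \<delta> \<in> C)"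

definition stationary_in :: "'v::zfc_universe set \<Rightarrow> 'v \<Rightarrow> bool" where
  "stationary_in S \<kappa> \<longleftrightarrow> S \<subseteq> elts \<kappa> \<and> (\<forall>C. club_in C \<kappa> \<longrightarrow> S \<inter> C \<noteq> {})"

definition ineffable :: "'v::zfc_universe \<Rightarrow> bool" where
  "ineffable \<kappa> \<longleftrightarrow> regular \<kappa> \<and> uncountable (elts \<kappa>) \<and>
     (\<forall>d. list_on \<kappa> d \<longrightarrow>
        (\<exists>D. elts D \<subseteq> elts \<kappa> \<and>
             stationary_in {\<alpha> \<in> elts \<kappa>. elts (d \<alpha>) = elts D \<inter> elts \<alpha>} \<kappa>))"


subsection \<open>The classes \<open>H(\<theta>)\<close>\<close>

definition tcl :: "'v::zfc_universe \<Rightarrow> 'v set" where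
  "tcl x = {y. (y, x) \<in> {(u, v). u \<in> elts v}\<^sup>+}"

definition H :: "'v::zfc_universe \<Rightarrow> 'v set" where
  "H \<theta> = {x. tcl x \<prec> elts \<theta>}"


subsection \<open>Elementary embeddings\<close>

text \<open>First-order formulas in the language of set theory, with variables named by natural numbers.\<close>

datatype fm =
    Mem nat nat
  | Eq nat nat
  | Neg fm
  | Conj fm fm
  | All nat fm

primrec sat :: "'v::zfc_universe set \<Rightarrow> fm \<Rightarrow> (nat \<Rightarrow> 'v) \<Rightarrow> bool" where
  "sat A (Mem m n) s \<longleftrightarrow> s m \<in> elts (s n)"
| "sat A (Eq m n) s \<longleftrightarrow> s m = s n"
| "sat A (Neg p) s \<longleftrightarrow> \<not> sat A p s"
| "sat A (Conj p q) s \<longleftrightarrow> sat A p s \<and> sat A q s"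
| "sat A (All n p) s \<longleftrightarrow> (\<forall>x\<in>A. sat A p (s(n := x)))"

definition elementary_embedding ::
  "('v::zfc_universe \<Rightarrow> 'v) \<Rightarrow> 'v set \<Rightarrow> 'v set \<Rightarrow> bool" where
  "elementary_embedding j M N \<longleftrightarrow> j ` M \<subseteq> N \<and>
     (\<forall>p s. range s \<subseteq> M \<longrightarrow> (sat M p s \<longleftrightarrow> sat N p (j \<circ> s)))"

definition moved :: "('v::zfc_universe \<Rightarrow> 'v) \<Rightarrow> 'v set \<Rightarrow> 'v \<Rightarrow> bool" where
  "moved j M \<alpha> \<longleftrightarrow> ordinal \<alpha> \<and> \<alpha> \<in> M \<and> \<alpha> \<in> elts (j \<alpha>)"

definition nontrivial :: "('v::zfc_universe \<Rightarrow> 'v) \<Rightarrow> 'v set \<Rightarrow> bool" where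
  "nontrivial j M \<longleftrightarrow> (\<exists>\<alpha>. moved j M \<alpha>)"

text \<open>The domain \<open>M\<close> is an argument because a HOL function does not determine it.\<close>

definition crit :: "('v::zfc_universe \<Rightarrow> 'v) \<Rightarrow> 'v set \<Rightarrow> 'v" where
  "crit j M = (THE \<alpha>. moved j M \<alpha> \<and> (\<forall>\<beta>. moved j M \<beta> \<longrightarrow> elts \<alpha> \<subseteq> elts \<beta>))"

definition small_embedding ::
  "'v::zfc_universe \<Rightarrow> 'v \<Rightarrow> 'v \<Rightarrow> ('v \<Rightarrow> 'v) \<Rightarrow> bool" where
  "small_embedding \<kappa> \<theta> M j \<longleftrightarrow>
     cardinal \<kappa> \<and> cardinal \<theta> \<and> \<kappa> \<in> elts \<theta> \<and>
     M \<in> H \<theta> \<and> transitive M \<and>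
     elementary_embedding j (elts M) (H \<theta>) \<and> nontrivial j (elts M) \<and>
     j (crit j (elts M)) = \<kappa>"

end

theory Submission imports Defs
begin

text \<open>
  The characterisation rests on elementary embeddings of transitive models into \<open>H(\<theta>)\<close> whose
  critical point \<open>\<beta>\<close> is sent to \<open>\<kappa>\<close>: such an embedding restricts subsets of \<open>\<kappa>\<close> in its range to
  \<open>\<beta>\<close>, since \<open>j(x) \<inter> \<beta> = x\<close> for \<open>x \<subseteq> \<beta>\<close> in the domain.

  Suppose that \<open>\<kappa>\<close> is ineffable, and let \<open>D\<close> agree with the list \<open>d\<close> on the stationary set
  \<open>{\<alpha>. d\<^sub>\<alpha> = D \<inter> \<alpha>}\<close>. For \<open>\<gamma> < \<kappa>\<close>, the Skolem hull of \<open>\<gamma> \<union> {\<kappa>, D, d}\<close> in \<open>H(\<theta>)\<close> has cardinality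
  less than \<open>\<kappa>\<close> (\<open>skolem_hull_lepoll\<close>), so its trace on \<open>\<kappa>\<close> is bounded. Hence there is a club of
  \<open>\<beta>\<close> for which the hull \<open>X\<close> of \<open>\<beta> \<union> {\<kappa>, D, d}\<close> satisfies \<open>X \<inter> \<kappa> = \<beta>\<close>
  (\<open>club_in_closure_points\<close>). For such a \<open>\<beta>\<close> in the stationary set, the inverse of the collapse of
  \<open>X\<close> (\<open>transitive_collapse\<close>) is a small embedding with critical point \<open>\<beta>\<close>, and the collapse sends
  \<open>D\<close> to \<open>D \<inter> \<beta> = d\<^sub>\<beta>\<close>.

  Conversely, given small embeddings, put \<open>D = j(d\<^sub>\<beta>)\<close> where \<open>\<beta>\<close> is the critical point, so that
  \<open>D \<inter> \<beta> = d\<^sub>\<beta>\<close>. If a club in \<open>\<kappa>\<close> avoided the set where \<open>d\<close> agrees with \<open>D\<close>, then by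
  elementarity so would a club of the form \<open>j(C)\<close>, but \<open>\<beta>\<close> is in \<open>j(C)\<close> as a limit of its points
  (\<open>small_embedding_imp_stationary\<close>). The regularity and the uncountability of \<open>\<kappa>\<close> also come from
  elementarity: the critical point is an infinite ordinal below the cardinal \<open>\<kappa>\<close>
  (\<open>small_embedding_crit_infinite\<close>), and a map that witnesses singularity would be reflected to one
  in the domain of \<open>j\<close>, whose image under \<open>j\<close> is bounded by \<open>\<beta>\<close> (\<open>small_embedding_imp_regular\<close>).
\<close>


section \<open>Classes that are sets\<close>

definition small :: "'v::zfc_universe set \<Rightarrow> bool" where
  "small A \<longleftrightarrow> A \<in> range elts"

lemma elts_inject: "elts x = elts y \<longleftrightarrow> x = y"
  by (auto dest: extensionality)

lemma small_elts [simp]: "small (elts x)"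
  by (simp add: small_def)

lemma elts_set_of [simp]: "small A \<Longrightarrow> elts (set_of A) = A"
  unfolding small_def set_of_def by (auto simp: elts_inject)

lemma smallE:
  assumes "small A"
  obtains x where "elts x = A"
  using assms elts_set_of by blast

lemma small_image:
  fixes f :: "'v::zfc_universe \<Rightarrow> 'v"
  assumes "small A"
  shows "small (f ` A)"
proof -
  obtain x where x: "elts x = A"
    using assms by (rule smallE)
  obtain y where "elts y = f ` elts x"
    using replacement[of f x] by (rule exE)
  then show ?thesis
    unfolding x by (metis small_elts)
qed

lemma small_subset:
  assumes "small A" "B \<subseteq> A"
  shows "small B"
proof -
  obtain x where x: "elts x = A"
    using assms(1) by (rule smallE)
  obtain y where "elts y = {z \<in> elts x. z \<in> B}"
    using separation[of x "\<lambda>z. z \<in> B"] by (rule exE)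
  then have "elts y = B"
    using x assms(2) by auto
  then show ?thesis
    by (metis small_elts)
qed

lemma small_doubleton [simp]: "small {a, b}"
proof -
  obtain z where "elts z = {a, b}"
    using pairing[of a b] by (rule exE)
  then show ?thesis
    by (metis small_elts)
qed

lemma small_singleton [simp]: "small {a}"
  using small_doubleton[of a a] by simp

lemma small_UN:
  fixes B :: "'v::zfc_universe \<Rightarrow> 'v set"
  assumes "small A" "\<And>a. a \<in> A \<Longrightarrow> small (B a)"
  shows "small (\<Union>a\<in>A. B a)"
proof -
  obtain x where x: "elts x = (\<lambda>a. set_of (B a)) ` A"
    using small_image[OF assms(1)] by (rule smallE)
  obtain y where "elts y = (\<Union>z\<in>elts x. elts z)"
    using union[of x] by (rule exE)
  also have "\<dots> = (\<Union>a\<in>A. B a)"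
    using assms(2) by (simp add: x)
  finally show ?thesis
    by (metis small_elts)
qed

lemma small_Un:
  assumes "small A" "small B"
  shows "small (A \<union> B)"
proof -
  have "small (\<Union>z\<in>{set_of A, set_of B}. elts z)"
    by (intro small_UN) auto
  then show ?thesis
    using assms by simp
qed

lemma small_Pow: "small {z. elts z \<subseteq> elts x}"
  using powerset[of x] by (metis small_elts)

lemma mem_irrefl: "x \<notin> elts x"
proof
  assume "x \<in> elts x"
  then show False
    using foundation[of "set_of {x}"] by auto
qed

text \<open>
  The axiom of infinity gives a set closed under \<open>y \<mapsto> y \<union> {y}\<close>; iterating the successor
  injects the natural numbers into it, so that replacement applies to countable families.
\<close>

lemma small_range_nat:
  fixes f :: "nat \<Rightarrow> 'v::zfc_universe"
  shows "small (range f)"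
proof -
  obtain x e :: 'v where e: "e \<in> elts x"
    and succ: "\<forall>y\<in>elts x. \<exists>z\<in>elts x. elts z = insert y (elts y)"
    using infinity by metis
  obtain s where s: "\<And>y. y \<in> elts x \<Longrightarrow> s y \<in> elts x \<and> elts (s y) = insert y (elts y)"
    using succ by metis
  define g where "g n = (s ^^ n) e" for n
  have gx: "g n \<in> elts x" for n
    by (induction n) (auto simp: g_def e s)
  have gSuc: "elts (g (Suc n)) = insert (g n) (elts (g n))" for n
    using s[OF gx[of n]] by (simp add: g_def)
  have less: "m < n \<Longrightarrow> g m \<in> elts (g n)" for m n
    by (induction n) (auto simp: gSuc less_Suc_eq)
  have inj: "inj g"
    by (rule injI) (metis less mem_irrefl linorder_less_linear)
  have "small (range g)"
    using gx by (auto intro: small_subset[OF small_elts[of x]])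
  then have "small ((\<lambda>z. f (inv g z)) ` range g)"
    by (rule small_image)
  also have "(\<lambda>z. f (inv g z)) ` range g = range f"
    using inj by (auto simp: image_image)
  finally show ?thesis .
qed

abbreviation mem_rel :: "('v::zfc_universe \<times> 'v) set" where
  "mem_rel \<equiv> {(u, v). u \<in> elts v}"

text \<open>
  The foundation axiom speaks about sets only, but a descending sequence in a class has a
  countable range, which is a set.
\<close>

lemma wf_mem_rel: "wf (mem_rel :: ('v::zfc_universe \<times> 'v) set)"
proof (unfold wf_iff_no_infinite_down_chain, rule notI, elim exE)
  fix f :: "nat \<Rightarrow> 'v"
  assume f: "\<forall>i. (f (Suc i), f i) \<in> mem_rel"
  have small: "small (range f)"
    by (rule small_range_nat)
  then obtain y where "y \<in> range f" "elts y \<inter> range f = {}"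
    using foundation[of "set_of (range f)"] by auto
  then show False
    using f by auto
qed

lemma mem_induct [case_names less]:
  assumes "\<And>x. (\<And>y. y \<in> elts x \<Longrightarrow> P y) \<Longrightarrow> P x"
  shows "P x"
  using wf_mem_rel by (rule wf_induct_rule) (use assms in auto)

lemma mem_minimal: "P x \<Longrightarrow> \<exists>y. P y \<and> (\<forall>z\<in>elts y. \<not> P z)"
  by (rule wfE_min[OF wf_mem_rel, of x "Collect P"]) auto


section \<open>The Mostowski collapse\<close>

text \<open>
  The relation is arbitrary because it is used both for membership on an elementary subclass and for
  a well-order of a set, where the collapse computes order types.
\<close>

definition collapse :: "('v::zfc_universe \<times> 'v) set \<Rightarrow> 'v \<Rightarrow> 'v" where
  "collapse R = wfrec R (\<lambda>f a. set_of (f ` {b. (b, a) \<in> R}))"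

lemma elts_collapse:
  assumes "wf R" "small {b. (b, a) \<in> R}"
  shows "elts (collapse R a) = collapse R ` {b. (b, a) \<in> R}"
proof -
  have "collapse R a = set_of (collapse R ` {b. (b, a) \<in> R})"
    by (subst def_wfrec[OF collapse_def[THEN eq_reflection] assms(1)])
       (auto intro!: arg_cong[where f = set_of] simp: cut_apply image_iff)
  then show ?thesis
    using assms(2) by (simp add: small_image)
qed

text \<open>
  By induction along \<open>R\<close>: if two points have the same value then their predecessors have the same
  values, hence coincide.
\<close>

lemma inj_on_collapse:
  assumes wf: "wf R" and R: "R \<subseteq> X \<times> X"
    and small: "\<And>a. a \<in> X \<Longrightarrow> small {b. (b, a) \<in> R}"
    and ext: "\<And>a b. a \<in> X \<Longrightarrow> b \<in> X \<Longrightarrow> {c. (c, a) \<in> R} = {c. (c, b) \<in> R} \<Longrightarrow> a = b"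
  shows "inj_on (collapse R) X"
proof (rule inj_onI)
  fix a b
  assume "a \<in> X" "b \<in> X" "collapse R a = collapse R b"
  then show "a = b"
  proof (induction a arbitrary: b rule: wf_induct_rule[OF wf])
    case (1 a)
    have eq: "collapse R ` {c. (c, a) \<in> R} = collapse R ` {c. (c, b) \<in> R}"
      using 1(2-4) elts_collapse[OF wf small] by metis
    have *: "c = c'" if "(c, a) \<in> R" "(c', b) \<in> R" "collapse R c = collapse R c'" for c c'
      using 1(1)[OF that(1) _ _ that(3)] that(1,2) R by blast
    have "(c, b) \<in> R" if c: "(c, a) \<in> R" for c
    proof -
      obtain c' where "(c', b) \<in> R" "collapse R c = collapse R c'"
        using eq c by blast
      then show ?thesis
        using *[OF c] by simp
    qed
    moreover have "(c, a) \<in> R" if c: "(c, b) \<in> R" for c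
    proof -
      obtain c' where "(c', a) \<in> R" "collapse R c' = collapse R c"
        using eq c by (metis (no_types, lifting) image_iff mem_Collect_eq)
      then show ?thesis
        using *[of c' c] c by blast
    qed
    ultimately have "{c. (c, a) \<in> R} = {c. (c, b) \<in> R}"
      by blast
    then show ?case
      using ext[OF 1(2,3)] by simp
  qed
qed

lemma collapse_mem_iff:
  assumes "wf R" "R \<subseteq> X \<times> X" "inj_on (collapse R) X"
    and "b \<in> X" "small {c. (c, a) \<in> R}"
  shows "collapse R b \<in> elts (collapse R a) \<longleftrightarrow> (b, a) \<in> R"
  using assms by (auto simp: elts_collapse inj_on_def)


section \<open>Ordinals and cardinals\<close>

lemma ordinal_elt: "ordinal \<alpha> \<Longrightarrow> \<beta> \<in> elts \<alpha> \<Longrightarrow> ordinal \<beta>"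
  unfolding ordinal_def transitive_def by blast

lemma ordinal_trans: "ordinal \<alpha> \<Longrightarrow> \<beta> \<in> elts \<alpha> \<Longrightarrow> \<gamma> \<in> elts \<beta> \<Longrightarrow> \<gamma> \<in> elts \<alpha>"
  unfolding ordinal_def transitive_def by blast

lemma ordinal_linear:
  assumes "ordinal \<alpha>" "ordinal \<beta>"
  shows "\<alpha> \<in> elts \<beta> \<or> \<alpha> = \<beta> \<or> \<beta> \<in> elts \<alpha>"
  using assms
proof (induction \<alpha> arbitrary: \<beta> rule: mem_induct)
  case (less \<alpha>)
  note IH\<alpha> = less.IH and \<alpha> = less.prems(1)
  show ?case
    using less.prems(2)
  proof (induction \<beta> rule: mem_induct)
    case (less \<beta>)
    have "\<alpha> = \<beta>" if "\<alpha> \<notin> elts \<beta>" "\<beta> \<notin> elts \<alpha>"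
    proof (intro extensionality equalityI subsetI)
      show "\<gamma> \<in> elts \<beta>" if "\<gamma> \<in> elts \<alpha>" for \<gamma>
        using IH\<alpha>[OF that ordinal_elt[OF \<alpha> that] less.prems] that \<open>\<beta> \<notin> elts \<alpha>\<close>
          ordinal_trans[OF \<alpha>] by blast
      show "\<gamma> \<in> elts \<alpha>" if "\<gamma> \<in> elts \<beta>" for \<gamma>
        using less.IH[OF that ordinal_elt[OF less.prems that]] that \<open>\<alpha> \<notin> elts \<beta>\<close>
          ordinal_trans[OF less.prems] by blast
    qed
    then show ?case
      by blast
  qed
qed

lemma ordinal_subset_or_mem:
  assumes "ordinal \<alpha>" "ordinal \<beta>"
  shows "elts \<alpha> \<subseteq> elts \<beta> \<or> \<beta> \<in> elts \<alpha>"
  using ordinal_linear[OF assms] ordinal_trans[OF assms(2)] by blast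

lemma ordinal_subset_cases:
  assumes "ordinal \<alpha>" "ordinal \<beta>" "elts \<alpha> \<subseteq> elts \<beta>"
  shows "\<alpha> \<in> elts \<beta> \<or> \<alpha> = \<beta>"
  using ordinal_linear[OF assms(1,2)] assms(3) mem_irrefl by blast

lemma ordinal_Union:
  assumes "small A" "\<And>\<alpha>. \<alpha> \<in> A \<Longrightarrow> ordinal \<alpha>"
  shows "ordinal (set_of (\<Union>\<alpha>\<in>A. elts \<alpha>))"
  using assms small_UN[OF assms(1), of elts] unfolding ordinal_def transitive_def by auto

lemma ordinal_elt_finite_bound:
  assumes "ordinal \<delta>" "finite F" "F \<noteq> {}" "F \<subseteq> elts \<delta>"
  obtains \<gamma> where "\<gamma> \<in> F" "\<And>\<xi>. \<xi> \<in> F \<Longrightarrow> elts \<xi> \<subseteq> elts \<gamma>"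
proof -
  have "\<exists>\<gamma>\<in>F. \<forall>\<xi>\<in>F. elts \<xi> \<subseteq> elts \<gamma>"
    using assms(2-4)
  proof (induction F rule: finite_ne_induct)
    case (insert x F)
    then obtain \<gamma> where \<gamma>: "\<gamma> \<in> F" "\<forall>\<xi>\<in>F. elts \<xi> \<subseteq> elts \<gamma>"
      by auto
    have "elts x \<subseteq> elts \<gamma> \<or> elts \<gamma> \<subseteq> elts x"
      using ordinal_subset_or_mem[of x \<gamma>] ordinal_elt[OF assms(1)] insert.prems \<gamma>
        ordinal_trans[of x \<gamma>] by blast
    then show ?case
      using \<gamma> by blast
  qed auto
  then show ?thesis
    using that by blast
qed

text \<open>
  Well-order \<open>x\<close> and collapse the well-order: every element is sent to the set of images of its
  predecessors, which is an ordinal.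
\<close>

lemma ex_ordinal_eqpoll:
  fixes x :: "'v::zfc_universe"
  shows "\<exists>\<alpha>::'v. ordinal \<alpha> \<and> elts \<alpha> \<approx> elts x"
proof -
  obtain r where r: "well_order_on (elts x) r"
    using well_order_on by blast
  define R where "R = r - Id"
  have wf: "wf R" and R: "R \<subseteq> elts x \<times> elts x" and tr: "trans R"
    and tot: "\<And>a b. a \<in> elts x \<Longrightarrow> b \<in> elts x \<Longrightarrow> a = b \<or> (a, b) \<in> R \<or> (b, a) \<in> R"
    using r unfolding R_def well_order_on_def linear_order_on_def partial_order_on_def
      preorder_on_def refl_on_def total_on_def
    by (auto simp: trans_diff_Id)
  have small: "small {b. (b, a) \<in> R}" for a
    using R by (auto intro: small_subset[OF small_elts[of x]])
  note elts = elts_collapse[OF wf small]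
  have "a = b" if "a \<in> elts x" "b \<in> elts x" "{c. (c, a) \<in> R} = {c. (c, b) \<in> R}" for a b
    using tot[OF that(1,2)] that(3) wf by (metis mem_Collect_eq wf_not_refl)
  then have inj: "inj_on (collapse R) (elts x)"
    using inj_on_collapse[OF wf R small] by blast
  define \<alpha> where "\<alpha> = set_of (collapse R ` elts x)"
  have \<alpha>: "elts \<alpha> = collapse R ` elts x"
    by (simp add: \<alpha>_def small_image)
  have "transitive (collapse R a)" for a
    unfolding transitive_def using tr by (auto simp: elts dest: transD)
  moreover have "transitive \<alpha>"
    unfolding transitive_def using R by (auto simp: elts \<alpha>)
  ultimately have "ordinal \<alpha>"
    unfolding ordinal_def \<alpha> by blast
  moreover have "elts \<alpha> \<approx> elts x"
    unfolding \<alpha> using inj by (rule inj_on_image_eqpoll_self)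
  ultimately show ?thesis
    by blast
qed

text \<open>
  The least ordinal of the given cardinality.
\<close>

lemma ex_cardinal_eqpoll:
  fixes x :: "'v::zfc_universe"
  shows "\<exists>\<theta>::'v. cardinal \<theta> \<and> elts \<theta> \<approx> elts x"
proof -
  obtain \<alpha> :: 'v where "ordinal \<alpha> \<and> elts \<alpha> \<approx> elts x"
    using ex_ordinal_eqpoll[of x] by (elim exE)
  then have "\<exists>\<theta>::'v. (ordinal \<theta> \<and> elts \<theta> \<approx> elts x) \<and>
      (\<forall>\<beta>\<in>elts \<theta>. \<not> (ordinal \<beta> \<and> elts \<beta> \<approx> elts x))"
    by (rule mem_minimal)
  then obtain \<theta> :: 'v where \<theta>: "ordinal \<theta>" "elts \<theta> \<approx> elts x"
    and min: "\<forall>\<beta>\<in>elts \<theta>. \<not> (ordinal \<beta> \<and> elts \<beta> \<approx> elts x)"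
    by (elim exE conjE)
  have "\<not> elts \<beta> \<approx> elts \<theta>" if "\<beta> \<in> elts \<theta>" for \<beta>
    using bspec[OF min that] ordinal_elt[OF \<theta>(1) that] eqpoll_trans[OF _ \<theta>(2)] by blast
  then show ?thesis
    unfolding cardinal_def using \<theta> by (intro exI[of _ \<theta>]) blast
qed

lemma ex_cardinal_gt:
  fixes x :: "'v::zfc_universe"
  shows "\<exists>\<theta>::'v. cardinal \<theta> \<and> elts x \<prec> elts \<theta>"
proof -
  obtain p where p: "elts p = {z. elts z \<subseteq> elts x}"
    using small_Pow by (rule smallE)
  have "elts ` elts p = Pow (elts x)"
    unfolding p by (auto simp: image_iff) (metis elts_set_of small_elts small_subset)
  then have "Pow (elts x) \<approx> elts p"
    by (metis eqpoll_sym extensionality inj_on_image_eqpoll_self inj_onI)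
  moreover obtain \<theta> :: 'v where "cardinal \<theta>" "elts \<theta> \<approx> elts p"
    using ex_cardinal_eqpoll[of p] by (elim exE conjE)
  ultimately show ?thesis
    using lesspoll_Pow_self by (metis eqpoll_sym lesspoll_eq_trans)
qed

lemma cardinal_ordinal: "cardinal \<kappa> \<Longrightarrow> ordinal \<kappa>"
  by (simp add: cardinal_def)

lemma cardinal_elt_lesspoll:
  assumes "cardinal \<kappa>" "\<alpha> \<in> elts \<kappa>"
  shows "elts \<alpha> \<prec> elts \<kappa>"
proof -
  have "elts \<alpha> \<subseteq> elts \<kappa>"
    using assms ordinal_trans[OF cardinal_ordinal] by blast
  then show ?thesis
    using assms unfolding lesspoll_def cardinal_def by (simp add: subset_imp_lepoll)
qed

lemma lesspoll_imp_mem: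
  assumes "ordinal \<alpha>" "ordinal \<theta>" "elts \<alpha> \<prec> elts \<theta>"
  shows "\<alpha> \<in> elts \<theta>"
proof -
  have "\<not> elts \<theta> \<subseteq> elts \<alpha>"
    using assms(3) by (metis lesspoll_not_refl lesspoll_trans1 subset_imp_lepoll)
  then show ?thesis
    using ordinal_subset_or_mem[OF assms(2,1)] by blast
qed


section \<open>Regular cardinals and closure points\<close>

text \<open>
  Otherwise \<open>\<kappa>\<close> would be embedded into the natural numbers by cardinality.
\<close>

lemma uncountable_ordinal_ex_infinite_elt:
  assumes "ordinal \<kappa>" "uncountable (elts \<kappa>)"
  obtains \<alpha> where "\<alpha> \<in> elts \<kappa>" "infinite (elts \<alpha>)"
proof (rule ccontr)
  assume "\<not> thesis"
  then have fin: "finite (elts \<alpha>)" if "\<alpha> \<in> elts \<kappa>" for \<alpha>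
    using that \<open>\<And>\<alpha>. \<alpha> \<in> elts \<kappa> \<Longrightarrow> infinite (elts \<alpha>) \<Longrightarrow> thesis\<close> by blast
  have card: "card (elts \<alpha>) < card (elts \<beta>)" if "\<beta> \<in> elts \<kappa>" "\<alpha> \<in> elts \<beta>" for \<alpha> \<beta>
  proof (rule psubset_card_mono)
    show "elts \<alpha> \<subset> elts \<beta>"
      using that ordinal_trans[OF ordinal_elt[OF assms(1)]] mem_irrefl by blast
  qed (use fin that in blast)
  have "inj_on (\<lambda>\<alpha>. card (elts \<alpha>)) (elts \<kappa>)"
  proof (rule inj_onI)
    fix \<alpha> \<beta>
    assume *: "\<alpha> \<in> elts \<kappa>" "\<beta> \<in> elts \<kappa>" "card (elts \<alpha>) = card (elts \<beta>)"
    then have "\<alpha> \<notin> elts \<beta>" "\<beta> \<notin> elts \<alpha>"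
      using card[of \<beta> \<alpha>] card[of \<alpha> \<beta>] by auto
    then show "\<alpha> = \<beta>"
      using ordinal_linear[of \<alpha> \<beta>] ordinal_elt[OF assms(1)] * by blast
  qed
  then show False
    using assms(2) countableI[of "\<lambda>\<alpha>. card (elts \<alpha>)" "elts \<kappa>"] by blast
qed

lemma regular_bounded:
  assumes "regular \<kappa>" "\<alpha> \<in> elts \<kappa>" "A \<lesssim> elts \<alpha>" "f ` A \<subseteq> elts \<kappa>"
  obtains \<beta> where "\<beta> \<in> elts \<kappa>" "\<And>a. a \<in> A \<Longrightarrow> f a \<in> elts \<beta>"
proof -
  obtain g where g: "A \<subseteq> g ` elts \<alpha>"
    using assms(3) unfolding lepoll_iff by (elim exE)
  \<comment> \<open>Indices outside of \<open>A\<close> are sent to an arbitrary element of \<open>\<kappa>\<close>.\<close>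
  define h where "h \<xi> = (if g \<xi> \<in> A then f (g \<xi>) else \<alpha>)" for \<xi>
  have "h ` elts \<alpha> \<subseteq> elts \<kappa>"
    using assms(2,4) by (auto simp: h_def)
  then obtain \<beta> where "\<beta> \<in> elts \<kappa>" "\<forall>\<xi>\<in>elts \<alpha>. h \<xi> \<in> elts \<beta>"
    using assms(1,2) unfolding regular_def by blast
  then show ?thesis
    using that[of \<beta>] g unfolding h_def by fastforce
qed

text \<open>
  An infinite ordinal below \<open>\<kappa>\<close> serves as the index set of a countable family.
\<close>

lemma regular_countable_bounded:
  assumes "regular \<kappa>" "uncountable (elts \<kappa>)" "countable A" "A \<subseteq> elts \<kappa>"
  obtains \<beta> where "\<beta> \<in> elts \<kappa>" "A \<subseteq> elts \<beta>"
proof -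
  obtain \<alpha> where \<alpha>: "\<alpha> \<in> elts \<kappa>" "infinite (elts \<alpha>)"
    using uncountable_ordinal_ex_infinite_elt assms(1,2)
    unfolding regular_def cardinal_def by blast
  have "A \<lesssim> (UNIV :: nat set)"
    using assms(3) by (auto simp: lepoll_def countable_def)
  then have "A \<lesssim> elts \<alpha>"
    using \<alpha>(2) unfolding infinite_le_lepoll by (rule lepoll_trans)
  then obtain \<beta> where "\<beta> \<in> elts \<kappa>" "\<And>a. a \<in> A \<Longrightarrow> a \<in> elts \<beta>"
    using regular_bounded[OF assms(1) \<alpha>(1), of A "\<lambda>a. a"] assms(4) by auto
  then show ?thesis
    using that by blast
qed

text \<open>
  Starting above \<open>\<beta>\<close>, iterate \<open>\<omega>\<close> times: go to an upper bound of the values of \<open>G\<close> below the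
  present ordinal. The supremum is a closure point, and it is below \<open>\<kappa>\<close> because the cofinality
  of \<open>\<kappa>\<close> is uncountable.
\<close>

lemma club_in_closure_points:
  fixes \<kappa> :: "'v::zfc_universe"
  assumes reg: "regular \<kappa>" and unc: "uncountable (elts \<kappa>)"
    and G: "\<And>\<gamma>. \<gamma> \<in> elts \<kappa> \<Longrightarrow> G \<gamma> \<in> elts \<kappa>"
  shows "club_in {\<delta> \<in> elts \<kappa>. elts \<delta> \<noteq> {} \<and> (\<forall>\<gamma>\<in>elts \<delta>. G \<gamma> \<in> elts \<delta>)} \<kappa>"
    (is "club_in ?C \<kappa>")
proof -
  have ord: "ordinal \<kappa>"
    using reg by (simp add: regular_def cardinal_def)
  have step: "\<exists>\<beta>'\<in>elts \<kappa>. \<beta> \<in> elts \<beta>' \<and> (\<forall>\<gamma>\<in>elts \<beta>. G \<gamma> \<in> elts \<beta>')" if \<beta>: "\<beta> \<in> elts \<kappa>" for \<beta>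
  proof -
    have "G ` elts \<beta> \<subseteq> elts \<kappa>"
      using G ordinal_trans[OF ord \<beta>] by blast
    then obtain \<epsilon> where \<epsilon>: "\<epsilon> \<in> elts \<kappa>" "\<And>\<gamma>. \<gamma> \<in> elts \<beta> \<Longrightarrow> G \<gamma> \<in> elts \<epsilon>"
      using regular_bounded[OF reg \<beta> lepoll_refl, of G] by blast
    obtain \<beta>' where \<beta>': "\<beta>' \<in> elts \<kappa>" "{\<beta>, \<epsilon>} \<subseteq> elts \<beta>'"
      using regular_countable_bounded[OF reg unc, of "{\<beta>, \<epsilon>}"] \<beta> \<epsilon>(1) by auto
    then show ?thesis
      using \<epsilon>(2) ordinal_trans[OF ordinal_elt[OF ord \<beta>'(1)]] by blast
  qed
  then obtain nx where nx: "\<And>\<beta>. \<beta> \<in> elts \<kappa> \<Longrightarrow>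
      nx \<beta> \<in> elts \<kappa> \<and> \<beta> \<in> elts (nx \<beta>) \<and> (\<forall>\<gamma>\<in>elts \<beta>. G \<gamma> \<in> elts (nx \<beta>))"
    by metis
  have "\<exists>\<delta>\<in>?C. \<beta> \<in> elts \<delta>" if \<beta>: "\<beta> \<in> elts \<kappa>" for \<beta>
  proof -
    define b where "b n = (nx ^^ Suc n) \<beta>" for n
    have b\<kappa>: "b n \<in> elts \<kappa>" for n
      by (induction n) (auto simp: b_def nx \<beta>)
    have bSuc: "b (Suc n) = nx (b n)" for n
      by (simp add: b_def)
    define \<delta> where "\<delta> = set_of (\<Union>\<xi>\<in>range b. elts \<xi>)"
    have \<delta>: "elts \<delta> = (\<Union>n. elts (b n))"
      unfolding \<delta>_def by (subst elts_set_of[OF small_UN[OF small_range_nat small_elts]]) blast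
    have ord\<delta>: "ordinal \<delta>"
      unfolding \<delta>_def using b\<kappa> ordinal_elt[OF ord] by (intro ordinal_Union small_range_nat) auto
    obtain \<epsilon> where \<epsilon>: "\<epsilon> \<in> elts \<kappa>" "range b \<subseteq> elts \<epsilon>"
      using regular_countable_bounded[OF reg unc, of "range b"] b\<kappa> by auto
    have "elts \<delta> \<subseteq> elts \<epsilon>"
      unfolding \<delta> using \<epsilon>(2) ordinal_trans[OF ordinal_elt[OF ord \<epsilon>(1)]] by blast
    then have "\<delta> \<in> elts \<kappa>"
      using ordinal_subset_cases[OF ord\<delta> ordinal_elt[OF ord \<epsilon>(1)]] \<epsilon>(1)
        ordinal_trans[OF ord \<epsilon>(1)] by auto
    moreover have "\<beta> \<in> elts (b 0)"
      using nx[OF \<beta>] by (simp add: b_def)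
    then have "\<beta> \<in> elts \<delta>"
      unfolding \<delta> by (rule UN_I[OF UNIV_I])
    moreover have "G \<gamma> \<in> elts \<delta>" if \<gamma>: "\<gamma> \<in> elts \<delta>" for \<gamma>
    proof -
      obtain n where "\<gamma> \<in> elts (b n)"
        using \<gamma> unfolding \<delta> by auto
      then have "G \<gamma> \<in> elts (b (Suc n))"
        using nx[OF b\<kappa>[of n]] bSuc by simp
      then show ?thesis
        unfolding \<delta> by (rule UN_I[OF UNIV_I])
    qed
    ultimately show ?thesis
      by (intro bexI[of _ \<delta>]) auto
  qed
  then have "unbounded_in ?C \<kappa>"
    unfolding unbounded_in_def by fastforce
  moreover have "\<delta> \<in> ?C" if \<delta>: "\<delta> \<in> elts \<kappa>" "elts \<delta> \<noteq> {}" "unbounded_in ?C \<delta>" for \<delta>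
  proof -
    have "G \<gamma> \<in> elts \<delta>" if \<gamma>: "\<gamma> \<in> elts \<delta>" for \<gamma>
    proof -
      obtain \<epsilon> where "\<epsilon> \<in> ?C" "\<epsilon> \<in> elts \<delta>" "\<gamma> \<in> elts \<epsilon>"
        using \<delta>(3) \<gamma> unfolding unbounded_in_def by blast
      then show ?thesis
        using ordinal_trans[OF ordinal_elt[OF ord \<delta>(1)]] by blast
    qed
    then show ?thesis
      using \<delta> by blast
  qed
  ultimately show ?thesis
    unfolding club_in_def by blast
qed


section \<open>The classes of sets of hereditarily small cardinality\<close>

definition transitive_class :: "'v::zfc_universe set \<Rightarrow> bool" where
  "transitive_class N \<longleftrightarrow> (\<forall>x\<in>N. elts x \<subseteq> N)"

lemma transitive_classD: "transitive_class N \<Longrightarrow> x \<in> N \<Longrightarrow> y \<in> elts x \<Longrightarrow> y \<in> N"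
  unfolding transitive_class_def by blast

lemma transitive_class_elts: "transitive x \<Longrightarrow> transitive_class (elts x)"
  by (simp add: transitive_class_def transitive_def)

lemma transitive_class_H: "transitive_class (H \<theta>)"
proof -
  have "y \<in> H \<theta>" if "x \<in> H \<theta>" "y \<in> elts x" for x y
  proof -
    have "tcl y \<subseteq> tcl x"
      using that(2) unfolding tcl_def by (auto intro: trancl_into_trancl)
    then show ?thesis
      using that(1) unfolding H_def by (auto intro: lesspoll_trans1 subset_imp_lepoll)
  qed
  then show ?thesis
    unfolding transitive_class_def by blast
qed

lemma tcl_subset:
  assumes "elts x \<subseteq> W" "transitive_class W"
  shows "tcl x \<subseteq> W"
proof
  fix y
  assume "y \<in> tcl x"
  then have "(y, x) \<in> mem_rel\<^sup>+"
    by (simp add: tcl_def)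
  then show "y \<in> W"
  proof (induction rule: converse_trancl_induct)
    case (base y)
    then show ?case
      using assms(1) by auto
  next
    case (step y z)
    then show ?case
      using transitive_classD[OF assms(2)] by auto
  qed
qed

lemma in_H:
  assumes "elts x \<subseteq> W" "transitive_class W" "W \<prec> elts \<theta>"
  shows "x \<in> H \<theta>"
  unfolding H_def using lesspoll_trans1[OF subset_imp_lepoll[OF tcl_subset[OF assms(1,2)]] assms(3)]
  by simp

lemma subset_of_elt_in_H:
  assumes "cardinal \<theta>" "\<kappa> \<in> elts \<theta>" "elts x \<subseteq> elts \<kappa>"
  shows "x \<in> H \<theta>"
proof (rule in_H[OF assms(3)])
  have "ordinal \<kappa>"
    using ordinal_elt[OF cardinal_ordinal] assms by blast
  then show "transitive_class (elts \<kappa>)"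
    by (intro transitive_class_elts) (simp add: ordinal_def)
  show "elts \<kappa> \<prec> elts \<theta>"
    using cardinal_elt_lesspoll assms by blast
qed


section \<open>Elementary subclasses\<close>

primrec fm_bound :: "fm \<Rightarrow> nat" where
  "fm_bound (Mem m n) = Suc (max m n)"
| "fm_bound (Eq m n) = Suc (max m n)"
| "fm_bound (Neg p) = fm_bound p"
| "fm_bound (Conj p q) = max (fm_bound p) (fm_bound q)"
| "fm_bound (All n p) = max (Suc n) (fm_bound p)"

lemma sat_cong: "(\<And>i. i < fm_bound p \<Longrightarrow> s i = t i) \<Longrightarrow> sat A p s \<longleftrightarrow> sat A p t"
proof (induction p arbitrary: s t)
  case (All n p)
  have "sat A p (s(n := x)) \<longleftrightarrow> sat A p (t(n := x))" for x
    using All.prems by (intro All.IH) auto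
  then show ?case
    by simp
next
  case (Conj p q)
  have "sat A p s \<longleftrightarrow> sat A p t" "sat A q s \<longleftrightarrow> sat A q t"
    using Conj.prems by (auto intro!: Conj.IH)
  then show ?case
    by simp
next
  case (Neg p)
  have "sat A p s \<longleftrightarrow> sat A p t"
    using Neg.prems by (intro Neg.IH) simp
  then show ?case
    by simp
qed simp_all

lemma Tarski_Vaught:
  assumes "X \<subseteq> N"
    and witness: "\<And>p n s y. range s \<subseteq> X \<Longrightarrow> y \<in> N \<Longrightarrow> sat N p (s(n := y)) \<Longrightarrow>
      \<exists>x\<in>X. sat N p (s(n := x))"
  shows "elementary_embedding (\<lambda>x. x) X N"
proof -
  have "sat X p s \<longleftrightarrow> sat N p s" if "range s \<subseteq> X" for p s
    using that
  proof (induction p arbitrary: s)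
    case (All n p)
    have "sat X p (s(n := x)) \<longleftrightarrow> sat N p (s(n := x))" if "x \<in> X" for x
      using All.prems that by (intro All.IH) auto
    moreover have "sat N p (s(n := y))" if "\<forall>x\<in>X. sat N p (s(n := x))" "y \<in> N" for y
      using witness[OF All.prems that(2), of "Neg p" n] that(1) by auto
    ultimately show ?case
      using assms(1) by auto
  qed auto
  then show ?thesis
    using assms(1) by (simp add: elementary_embedding_def comp_def)
qed

lemma range_fun_upd_subset: "range s \<subseteq> A \<Longrightarrow> x \<in> A \<Longrightarrow> range (s(n := x)) \<subseteq> A"
  by auto

lemma sat_isomorphism:
  assumes bij: "bij_betw j M X"
    and mem: "\<And>x y. x \<in> M \<Longrightarrow> y \<in> M \<Longrightarrow> j x \<in> elts (j y) \<longleftrightarrow> x \<in> elts y"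
    and s: "range s \<subseteq> M"
  shows "sat M p s \<longleftrightarrow> sat X p (j \<circ> s)"
  using s
proof (induction p arbitrary: s)
  case (Mem m n)
  then have "s m \<in> M" "s n \<in> M"
    by auto
  then show ?case
    using mem by simp
next
  case (Eq m n)
  then have "s m \<in> M" "s n \<in> M"
    by auto
  then show ?case
    using bij inj_on_eq_iff[of j M "s m" "s n"] by (simp add: bij_betw_def)
next
  case (All n p)
  have "sat M p (s(n := x)) \<longleftrightarrow> sat X p ((j \<circ> s)(n := j x))" if "x \<in> M" for x
    using All.IH[OF range_fun_upd_subset[OF All.prems that]] by (simp only: fun_upd_comp)
  moreover have "X = j ` M"
    using bij by (simp add: bij_betw_def)
  ultimately show ?case
    by (simp add: comp_def)
qed auto

text \<open>
  An elementary subclass of a transitive class is extensional: if two of its members differ, then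
  by elementarity it contains a witness for that. So its collapse is an isomorphism.
\<close>

lemma transitive_collapse:
  fixes N :: "'v::zfc_universe set"
  assumes elem: "elementary_embedding (\<lambda>x. x) X N" and N: "transitive_class N" and X: "small X"
  obtains M \<pi> where "transitive M" "elts M = \<pi> ` X" "inj_on \<pi> X"
    "elementary_embedding (inv_into X \<pi>) (elts M) N"
    "\<And>x. x \<in> X \<Longrightarrow> elts (\<pi> x) = \<pi> ` (X \<inter> elts x)"
proof -
  have XN: "X \<subseteq> N"
    using elem by (simp add: elementary_embedding_def)
  have sat: "sat X p s \<longleftrightarrow> sat N p s" if "range s \<subseteq> X" for p s
    using elem that by (simp add: elementary_embedding_def comp_def)
  define R where "R = {(y, x). x \<in> X \<and> y \<in> X \<and> y \<in> elts x}"
  define \<pi> where "\<pi> = collapse R"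
  define M where "M = set_of (\<pi> ` X)"
  have wf: "wf R"
    by (rule wf_subset[OF wf_mem_rel]) (auto simp: R_def)
  have R: "R \<subseteq> X \<times> X"
    by (auto simp: R_def)
  have pred: "{y. (y, x) \<in> R} = X \<inter> elts x" if "x \<in> X" for x
    using that by (auto simp: R_def)
  have small: "small {y. (y, x) \<in> R}" if "x \<in> X" for x
    unfolding pred[OF that] by (rule small_subset[OF X]) simp
  have elts_\<pi>: "elts (\<pi> x) = \<pi> ` (X \<inter> elts x)" if "x \<in> X" for x
    unfolding \<pi>_def elts_collapse[OF wf small[OF that]] pred[OF that] ..
  have ext: "x = y" if xy: "x \<in> X" "y \<in> X" "{z. (z, x) \<in> R} = {z. (z, y) \<in> R}" for x y
  proof -
    let ?p = "All 2 (Conj (Neg (Conj (Mem 2 0) (Neg (Mem 2 1))))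
                         (Neg (Conj (Mem 2 1) (Neg (Mem 2 0)))))"
    let ?s = "(\<lambda>i::nat. x)(1 := y)"
    have "X \<inter> elts x = X \<inter> elts y"
      using xy(3) by (simp add: pred[OF xy(1)] pred[OF xy(2)])
    then have "sat X ?p ?s"
      by auto
    moreover have "range ?s \<subseteq> X"
      using xy by auto
    ultimately have "sat N ?p ?s"
      using sat by blast
    then have "N \<inter> elts x = N \<inter> elts y"
      by auto
    moreover have "elts x \<subseteq> N" "elts y \<subseteq> N"
      using N XN xy unfolding transitive_class_def by auto
    ultimately show ?thesis
      by (intro extensionality) blast
  qed
  have inj: "inj_on \<pi> X"
    unfolding \<pi>_def using wf R small ext by (rule inj_on_collapse)
  have M: "elts M = \<pi> ` X"
    by (simp add: M_def small_image X)
  have trans: "transitive M"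
    unfolding transitive_def M by (auto simp: elts_\<pi>)
  let ?j = "inv_into X \<pi>"
  have j: "?j (\<pi> x) = x" if "x \<in> X" for x
    using inj that by simp
  have bij: "bij_betw ?j (elts M) X"
    unfolding M using inj by (simp add: inj_on_imp_bij_betw bij_betw_inv_into)
  have "?j u \<in> elts (?j v) \<longleftrightarrow> u \<in> elts v" if uv: "u \<in> elts M" "v \<in> elts M" for u v
  proof -
    obtain x y where xy: "x \<in> X" "u = \<pi> x" "y \<in> X" "v = \<pi> y"
      using uv M by auto
    have "\<pi> x \<in> elts (\<pi> y) \<longleftrightarrow> (x, y) \<in> R"
      unfolding \<pi>_def
      using collapse_mem_iff[OF wf R inj[unfolded \<pi>_def] xy(1) small[OF xy(3)]] .
    then show ?thesis
      using xy j by (simp add: R_def)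
  qed
  then have iso: "sat (elts M) p s \<longleftrightarrow> sat X p (?j \<circ> s)" if "range s \<subseteq> elts M" for p s
    using sat_isomorphism[OF bij _ that] by blast
  have "elementary_embedding ?j (elts M) N"
    unfolding elementary_embedding_def
  proof (intro conjI allI impI)
    have jX: "?j ` elts M = X"
      using bij by (simp add: bij_betw_def)
    then show "?j ` elts M \<subseteq> N"
      using XN by simp
    fix p and s :: "nat \<Rightarrow> 'v"
    assume s: "range s \<subseteq> elts M"
    then have "range (?j \<circ> s) \<subseteq> X"
      using jX by auto
    then show "sat (elts M) p s \<longleftrightarrow> sat N p (?j \<circ> s)"
      using iso[OF s] sat by blast
  qed
  then show ?thesis
    using that[OF trans M inj _ elts_\<pi>] by blast
qed


section \<open>Skolem hulls\<close>

instance fm :: countable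
  by countable_datatype

text \<open>
  A Skolem function takes the finite list of values of the variables that occur in its formula. The
  default value is not seen by a formula with \<open>fm_bound\<close> at most the length of the list.
\<close>

definition list_assignment :: "'a list \<Rightarrow> nat \<Rightarrow> 'a" where
  "list_assignment xs i = (if i < length xs then xs ! i else undefined)"

definition skolem :: "'v::zfc_universe set \<Rightarrow> fm \<Rightarrow> nat \<Rightarrow> 'v list \<Rightarrow> 'v" where
  "skolem N p n xs = (SOME y. y \<in> N \<and> sat N p ((list_assignment xs)(n := y)))"

text \<open>
  Values of Skolem functions are adjoined only where a witness exists, which keeps the hull inside
  \<open>N\<close>.
\<close>

primrec hull_level :: "'v::zfc_universe set \<Rightarrow> 'v set \<Rightarrow> nat \<Rightarrow> 'v set" where
  "hull_level N Y 0 = Y"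
| "hull_level N Y (Suc k) = hull_level N Y k \<union>
     {skolem N p n xs | p n xs. set xs \<subseteq> hull_level N Y k \<and>
        (\<exists>y\<in>N. sat N p ((list_assignment xs)(n := y)))}"

definition skolem_hull :: "'v::zfc_universe set \<Rightarrow> 'v set \<Rightarrow> 'v set" where
  "skolem_hull N Y = (\<Union>k. hull_level N Y k)"

lemma skolem:
  assumes "y \<in> N" "sat N p ((list_assignment xs)(n := y))"
  shows "skolem N p n xs \<in> N" "sat N p ((list_assignment xs)(n := skolem N p n xs))"
proof -
  have "skolem N p n xs \<in> N \<and> sat N p ((list_assignment xs)(n := skolem N p n xs))"
    unfolding skolem_def
    by (rule someI[where P = "\<lambda>y. y \<in> N \<and> sat N p ((list_assignment xs)(n := y))"])
       (use assms in simp)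
  then show "skolem N p n xs \<in> N" "sat N p ((list_assignment xs)(n := skolem N p n xs))"
    by auto
qed

lemma finite_subset_directed_UN:
  assumes "finite F" "F \<subseteq> (\<Union>i\<in>I. A i)" "I \<noteq> {}"
    and directed: "\<And>i j. i \<in> I \<Longrightarrow> j \<in> I \<Longrightarrow> \<exists>k\<in>I. A i \<union> A j \<subseteq> A k"
  shows "\<exists>i\<in>I. F \<subseteq> A i"
  using assms(1,2)
proof (induction F)
  case empty
  then show ?case
    using assms(3) by blast
next
  case (insert x F)
  then obtain i j where "i \<in> I" "F \<subseteq> A i" "j \<in> I" "x \<in> A j"
    by auto
  then show ?case
    using directed[of i j] by blast
qed

lemma hull_level_mono: "k \<le> l \<Longrightarrow> hull_level N Y k \<subseteq> hull_level N Y l"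
  by (induction l) (auto simp: le_Suc_eq)

lemma skolem_in_hull_level:
  assumes "set xs \<subseteq> hull_level N Y k" "y \<in> N" "sat N p ((list_assignment xs)(n := y))"
  shows "skolem N p n xs \<in> hull_level N Y (Suc k)"
  using assms by (auto intro!: exI[of _ p] exI[of _ n] exI[of _ xs])

lemma subset_skolem_hull: "Y \<subseteq> skolem_hull N Y"
  unfolding skolem_hull_def by (metis UN_upper UNIV_I hull_level.simps(1))

lemma skolem_hull_subset:
  assumes "Y \<subseteq> N"
  shows "skolem_hull N Y \<subseteq> N"
proof -
  have "hull_level N Y k \<subseteq> N" for k
    using assms by (induction k) (auto intro: skolem)
  then show ?thesis
    unfolding skolem_hull_def by blast
qed

text \<open>
  The finitely many parameters of a formula all appear at one level, and the next level contains the
  witness.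
\<close>

lemma elementary_skolem_hull:
  assumes "Y \<subseteq> N"
  shows "elementary_embedding (\<lambda>x. x) (skolem_hull N Y) N"
proof (rule Tarski_Vaught[OF skolem_hull_subset[OF assms]])
  fix p n y and s :: "nat \<Rightarrow> 'a"
  assume s: "range s \<subseteq> skolem_hull N Y" and y: "y \<in> N" "sat N p (s(n := y))"
  define xs where "xs = map s [0..<fm_bound p]"
  have "set xs \<subseteq> (\<Union>k\<in>UNIV. hull_level N Y k)"
    using s unfolding xs_def skolem_hull_def by auto
  moreover have "\<exists>m\<in>UNIV. hull_level N Y k \<union> hull_level N Y l \<subseteq> hull_level N Y m" for k l
    using hull_level_mono[of k "max k l" N Y] hull_level_mono[of l "max k l" N Y] by auto
  ultimately obtain k where k: "set xs \<subseteq> hull_level N Y k"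
    using finite_subset_directed_UN[of "set xs" "hull_level N Y" UNIV] by auto
  have cong: "sat N p ((list_assignment xs)(n := z)) \<longleftrightarrow> sat N p (s(n := z))" for z
    by (rule sat_cong) (simp add: list_assignment_def xs_def)
  have "skolem N p n xs \<in> hull_level N Y (Suc k)"
    using k y(1) y(2)[folded cong] by (rule skolem_in_hull_level)
  then have "skolem N p n xs \<in> skolem_hull N Y"
    unfolding skolem_hull_def by blast
  moreover have "sat N p (s(n := skolem N p n xs))"
    using skolem(2)[of y N p xs n] y cong by simp
  ultimately show "\<exists>x\<in>skolem_hull N Y. sat N p (s(n := x))"
    by blast
qed

lemma hull_level_subset_mono:
  assumes "Y \<subseteq> Z"
  shows "hull_level N Y k \<subseteq> hull_level N Z k"
proof (induction k)
  case (Suc k)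
  then show ?case
    by fastforce
qed (simp add: assms)

text \<open>
  Skolem functions have finitely many arguments, so an element of the hull of a directed union is
  already generated by one of the members.
\<close>

lemma skolem_hull_directed_UN:
  assumes "I \<noteq> {}"
    and directed: "\<And>i j. i \<in> I \<Longrightarrow> j \<in> I \<Longrightarrow> \<exists>k\<in>I. Y i \<union> Y j \<subseteq> Y k"
  shows "skolem_hull N (\<Union>i\<in>I. Y i) \<subseteq> (\<Union>i\<in>I. skolem_hull N (Y i))"
proof -
  have "hull_level N (\<Union>i\<in>I. Y i) k \<subseteq> (\<Union>i\<in>I. hull_level N (Y i) k)" for k
  proof (induction k)
    case (Suc k)
    have dir: "\<exists>l\<in>I. hull_level N (Y i) k \<union> hull_level N (Y j) k \<subseteq> hull_level N (Y l) k"
      if "i \<in> I" "j \<in> I" for i j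
    proof -
      obtain l where "l \<in> I" "Y i \<subseteq> Y l" "Y j \<subseteq> Y l"
        using directed[OF \<open>i \<in> I\<close> \<open>j \<in> I\<close>] by auto
      then show ?thesis
        using hull_level_subset_mono[of _ "Y l" N k] by (intro bexI[of _ l] Un_least) auto
    qed
    show ?case
    proof
      fix x
      assume "x \<in> hull_level N (\<Union>i\<in>I. Y i) (Suc k)"
      then consider "x \<in> hull_level N (\<Union>i\<in>I. Y i) k"
        | p n xs where "x = skolem N p n xs" "set xs \<subseteq> hull_level N (\<Union>i\<in>I. Y i) k"
          "\<exists>y\<in>N. sat N p ((list_assignment xs)(n := y))"
        by auto
      then show "x \<in> (\<Union>i\<in>I. hull_level N (Y i) (Suc k))"
      proof cases
        case 1
        then show ?thesis
          using Suc by auto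
      next
        case 2
        have "set xs \<subseteq> (\<Union>i\<in>I. hull_level N (Y i) k)"
          using 2(2) Suc by (rule order_trans)
        then obtain i where i: "i \<in> I" "set xs \<subseteq> hull_level N (Y i) k"
          using finite_subset_directed_UN[of "set xs" "\<lambda>i. hull_level N (Y i) k" I] dir assms(1)
          by auto
        then show ?thesis
          using 2 skolem_in_hull_level[OF i(2)] by blast
      qed
    qed
  qed simp
  then show ?thesis
    unfolding skolem_hull_def by blast
qed

lemma countable_lepoll_infinite: "countable A \<Longrightarrow> infinite B \<Longrightarrow> A \<lesssim> B"
  using lepoll_trans[of A "UNIV :: nat set" B]
  by (auto simp: infinite_le_lepoll countable_def lepoll_def)

lemma UN_lepoll_infinite:
  assumes "infinite B" "I \<lesssim> B" "\<And>i. i \<in> I \<Longrightarrow> A i \<lesssim> B"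
  shows "(\<Union>i\<in>I. A i) \<lesssim> B"
  using card_of_UNION_ordLeq_infinite[of B I A] assms by (simp add: lepoll_def card_of_ordLeq)

lemma Un_lepoll_infinite:
  assumes "infinite B" "A \<lesssim> B" "C \<lesssim> B"
  shows "A \<union> C \<lesssim> B"
  using UN_lepoll_infinite[OF assms(1), of "{A, C}" "\<lambda>x. x"] assms
  by (auto simp: countable_lepoll_infinite)

lemma lists_lepoll_infinite:
  assumes "infinite B"
  shows "lists B \<lesssim> B"
proof -
  let ?L = "\<lambda>n. {xs \<in> lists B. length xs = n}"
  have "?L n \<lesssim> B" for n
  proof (induction n)
    case 0
    show ?case
      using assms by (intro countable_lepoll_infinite) (auto intro: countable_subset[of _ "{[]}"])
  next
    case (Suc n)
    have "?L (Suc n) = (\<Union>x\<in>B. Cons x ` ?L n)"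
      by (auto simp: length_Suc_conv image_iff)
    also have "\<dots> \<lesssim> B"
      using assms Suc by (intro UN_lepoll_infinite) auto
    finally show ?case .
  qed
  then have "(\<Union>n. ?L n) \<lesssim> B"
    using assms by (intro UN_lepoll_infinite) (auto intro: countable_lepoll_infinite)
  moreover have "(\<Union>n. ?L n) = lists B"
    by auto
  ultimately show ?thesis
    by simp
qed

text \<open>
  There are countably many formulas, and no more finite lists over an infinite set than elements.
\<close>

lemma skolem_hull_lepoll:
  assumes "infinite B" "Y \<lesssim> B"
  shows "skolem_hull N Y \<lesssim> B"
proof -
  have "hull_level N Y k \<lesssim> B" for k
  proof (induction k)
    case (Suc k)
    let ?L = "hull_level N Y k"
    have "lists ?L \<lesssim> B"
      using lists_lepoll_mono[OF Suc] lists_lepoll_infinite[OF assms(1)] by (rule lepoll_trans)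
    then have "(\<Union>p. \<Union>n. skolem N p n ` lists ?L) \<lesssim> B"
      using assms(1) lepoll_trans[OF image_lepoll]
      by (intro UN_lepoll_infinite) (auto intro: countable_lepoll_infinite)
    moreover have "hull_level N Y (Suc k) \<subseteq> ?L \<union> (\<Union>p. \<Union>n. skolem N p n ` lists ?L)"
      by auto
    ultimately show ?case
      using Un_lepoll_infinite[OF assms(1) Suc] lepoll_trans[OF subset_imp_lepoll] by blast
  qed (simp add: assms(2))
  then show ?thesis
    unfolding skolem_hull_def using assms(1)
    by (intro UN_lepoll_infinite) (auto intro: countable_lepoll_infinite)
qed


section \<open>Small embeddings from ineffability\<close>

definition powset :: "'v::zfc_universe \<Rightarrow> 'v" where
  "powset x = set_of {z. elts z \<subseteq> elts x}"

lemma elts_powset [simp]: "elts (powset x) = {z. elts z \<subseteq> elts x}"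
  by (simp add: powset_def small_Pow)

lemma transitive_powset: "transitive x \<Longrightarrow> transitive (powset x)"
  unfolding transitive_def by fastforce

lemma subset_powset: "transitive x \<Longrightarrow> elts x \<subseteq> elts (powset x)"
  unfolding transitive_def by auto

lemma kpair_in_powset:
  assumes "a \<in> elts x" "b \<in> elts x"
  shows "kpair a b \<in> elts (powset (powset x))"
  using assms by (simp add: kpair_def)

lemma elts_seq: "elts (seq A f) = (\<lambda>a. kpair a (f a)) ` elts A"
  by (simp add: seq_def small_image)

text \<open>
  All these sequences are subsets of the third iterated power set of \<open>\<kappa>\<close>, so any cardinal above
  the cardinality of that set works.
\<close>

lemma ex_cardinal_seq_in_H:
  fixes \<kappa> :: "'v::zfc_universe"
  assumes "ordinal \<kappa>"
  obtains \<alpha> where "ordinal \<alpha>" "\<kappa> \<in> elts \<alpha>"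
    "\<And>\<theta> \<gamma> f. cardinal \<theta> \<Longrightarrow> \<alpha> \<in> elts \<theta> \<Longrightarrow> elts \<gamma> \<subseteq> elts \<kappa> \<Longrightarrow>
       (\<And>\<xi>. \<xi> \<in> elts \<gamma> \<Longrightarrow> elts (f \<xi>) \<subseteq> elts \<kappa>) \<Longrightarrow> seq \<gamma> f \<in> H \<theta>"
proof -
  define W where "W = powset (powset (powset \<kappa>))"
  have tr: "transitive \<kappa>"
    using assms by (simp add: ordinal_def)
  have trW: "transitive W"
    unfolding W_def by (intro transitive_powset tr)
  have \<kappa>_powset: "elts \<kappa> \<subseteq> elts (powset \<kappa>)"
    using tr by (rule subset_powset)
  obtain \<alpha> :: 'v where \<alpha>: "cardinal \<alpha>" "elts W \<prec> elts \<alpha>"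
    using ex_cardinal_gt[of W] by (elim exE conjE)
  have ord: "ordinal \<alpha>"
    using \<alpha>(1) by (rule cardinal_ordinal)
  have "elts (powset \<kappa>) \<subseteq> elts (powset (powset \<kappa>))" "elts (powset (powset \<kappa>)) \<subseteq> elts W"
    unfolding W_def by (intro subset_powset transitive_powset tr)+
  then have "elts \<kappa> \<subseteq> elts W"
    using \<kappa>_powset by (blast intro: subset_trans)
  then have "elts \<kappa> \<prec> elts \<alpha>"
    using \<alpha>(2) lesspoll_trans1 subset_imp_lepoll by blast
  then have "\<kappa> \<in> elts \<alpha>"
    using assms ord lesspoll_imp_mem by blast
  moreover have "seq \<gamma> f \<in> H \<theta>"
    if \<theta>: "cardinal \<theta>" "\<alpha> \<in> elts \<theta>" and \<gamma>: "elts \<gamma> \<subseteq> elts \<kappa>"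
      and f: "\<And>\<xi>. \<xi> \<in> elts \<gamma> \<Longrightarrow> elts (f \<xi>) \<subseteq> elts \<kappa>" for \<theta> \<gamma> f
  proof (rule in_H)
    have "kpair \<xi> (f \<xi>) \<in> elts W" if "\<xi> \<in> elts \<gamma>" for \<xi>
      unfolding W_def by (rule kpair_in_powset) (use f[OF that] that \<gamma> \<kappa>_powset in auto)
    then show "elts (seq \<gamma> f) \<subseteq> elts W"
      by (auto simp: elts_seq)
    show "transitive_class (elts W)"
      using trW by (rule transitive_class_elts)
    show "elts W \<prec> elts \<theta>"
      using \<alpha>(2) cardinal_elt_lesspoll[OF \<theta>] by (rule lesspoll_trans)
  qed
  ultimately show ?thesis
    using that ord by blast
qed

lemma crit_eqI:
  assumes "moved j M \<beta>" "\<And>\<gamma>. \<gamma> \<in> elts \<beta> \<Longrightarrow> j \<gamma> = \<gamma>"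
  shows "crit j M = \<beta>"
proof -
  have least: "elts \<beta> \<subseteq> elts \<gamma>" if "moved j M \<gamma>" for \<gamma>
  proof -
    have "\<gamma> \<notin> elts \<beta>"
      using assms(2)[of \<gamma>] that mem_irrefl[of \<gamma>] unfolding moved_def by auto
    then show ?thesis
      using ordinal_subset_or_mem[of \<beta> \<gamma>] that assms(1) unfolding moved_def by blast
  qed
  show ?thesis
    unfolding crit_def
  proof (rule the_equality)
    show "moved j M \<beta> \<and> (\<forall>\<gamma>. moved j M \<gamma> \<longrightarrow> elts \<beta> \<subseteq> elts \<gamma>)"
      using assms(1) least by blast
    show "\<alpha> = \<beta>" if "moved j M \<alpha> \<and> (\<forall>\<gamma>. moved j M \<gamma> \<longrightarrow> elts \<alpha> \<subseteq> elts \<gamma>)" for \<alpha>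
      using that assms(1) least[of \<alpha>] by (intro extensionality) blast
  qed
qed

text \<open>
  The domain \<open>M\<close> is the collapse \<open>\<pi>\<close> of a Skolem hull \<open>X\<close> with \<open>D \<in> X\<close> and \<open>X \<inter> \<kappa> = \<beta>\<close>, where \<open>\<beta>\<close>
  is chosen such that \<open>d\<^sub>\<beta> = D \<inter> \<beta>\<close>. Then \<open>\<pi>\<close> is the identity on \<open>\<beta>\<close>, \<open>\<pi>(\<kappa>) = X \<inter> \<kappa> = \<beta>\<close> and
  \<open>\<pi>(D) = D \<inter> \<beta>\<close>.
\<close>

lemma ineffable_imp_small_embedding:
  fixes \<kappa> :: "'v::zfc_universe"
  assumes ineffable: "ineffable \<kappa>" and \<theta>: "cardinal \<theta>" "\<kappa> \<in> elts \<theta>"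
    and d: "list_on \<kappa> d" and seq: "seq \<kappa> d \<in> H \<theta>"
  shows "\<exists>M j. small_embedding \<kappa> \<theta> M j \<and> seq \<kappa> d \<in> j ` elts M \<and>
    d (crit j (elts M)) \<in> elts M"
proof -
  have reg: "regular \<kappa>" and unc: "uncountable (elts \<kappa>)"
    using ineffable by (simp_all add: ineffable_def)
  then have card: "cardinal \<kappa>"
    by (simp add: regular_def)
  then have ord: "ordinal \<kappa>"
    by (rule cardinal_ordinal)
  obtain D where D: "elts D \<subseteq> elts \<kappa>"
    and stat: "stationary_in {\<alpha> \<in> elts \<kappa>. elts (d \<alpha>) = elts D \<inter> elts \<alpha>} \<kappa>"
    using ineffable d unfolding ineffable_def by blast
  define P where "P = {\<kappa>, D, seq \<kappa> d}"
  have P: "P \<subseteq> H \<theta>"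
    using seq subset_of_elt_in_H[OF \<theta>] D by (auto simp: P_def)
  define X where "X \<gamma> = skolem_hull (H \<theta>) (elts \<gamma> \<union> P)" for \<gamma>

  obtain \<alpha> where \<alpha>: "\<alpha> \<in> elts \<kappa>" "infinite (elts \<alpha>)"
    using uncountable_ordinal_ex_infinite_elt[OF ord unc] by blast
  \<comment> \<open>The infinite \<open>\<alpha>\<close> absorbs the parameters and the formulas when \<open>\<gamma>\<close> is finite.\<close>
  have size: "\<exists>\<mu>\<in>elts \<kappa>. infinite (elts \<mu>) \<and> elts \<gamma> \<subseteq> elts \<mu> \<and> X \<gamma> \<lesssim> elts \<mu>"
    if \<gamma>: "\<gamma> \<in> elts \<kappa>" for \<gamma>
  proof -
    obtain \<mu> where \<mu>: "\<mu> \<in> elts \<kappa>" "elts \<gamma> \<subseteq> elts \<mu>" "elts \<alpha> \<subseteq> elts \<mu>"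
      using ordinal_subset_or_mem[of \<gamma> \<alpha>] ordinal_elt[OF ord] ordinal_trans[of \<gamma> \<alpha>] \<gamma> \<alpha>(1)
      by blast
    have inf: "infinite (elts \<mu>)"
      using \<mu>(3) \<alpha>(2) finite_subset by blast
    have "elts \<gamma> \<union> P \<lesssim> elts \<mu>"
      using \<mu>(2) inf
      by (intro Un_lepoll_infinite countable_lepoll_infinite subset_imp_lepoll) (auto simp: P_def)
    then have "X \<gamma> \<lesssim> elts \<mu>"
      unfolding X_def using inf by (intro skolem_hull_lepoll)
    then show ?thesis
      using \<mu> inf by blast
  qed
  \<comment> \<open>The bound is also above \<open>\<gamma>\<close>, so that closure points are limit ordinals.\<close>
  have "\<exists>\<beta>\<in>elts \<kappa>. \<gamma> \<in> elts \<beta> \<and> X \<gamma> \<inter> elts \<kappa> \<subseteq> elts \<beta>" if \<gamma>: "\<gamma> \<in> elts \<kappa>" for \<gamma>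
  proof -
    obtain \<mu> where \<mu>: "\<mu> \<in> elts \<kappa>" "infinite (elts \<mu>)" "X \<gamma> \<lesssim> elts \<mu>"
      using size[OF \<gamma>] by blast
    have "{\<gamma>} \<union> X \<gamma> \<inter> elts \<kappa> \<lesssim> elts \<mu>"
    proof (rule Un_lepoll_infinite[OF \<mu>(2)])
      show "{\<gamma>} \<lesssim> elts \<mu>"
        using \<mu>(2) by (simp add: countable_lepoll_infinite)
      show "X \<gamma> \<inter> elts \<kappa> \<lesssim> elts \<mu>"
        using subset_imp_lepoll[OF Int_lower1] \<mu>(3) by (rule lepoll_trans)
    qed
    then obtain \<beta> where "\<beta> \<in> elts \<kappa>" "\<And>\<xi>. \<xi> \<in> {\<gamma>} \<union> X \<gamma> \<inter> elts \<kappa> \<Longrightarrow> \<xi> \<in> elts \<beta>"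
      using regular_bounded[OF reg \<mu>(1), of "{\<gamma>} \<union> X \<gamma> \<inter> elts \<kappa>" "\<lambda>\<xi>. \<xi>"] \<gamma> by auto
    then show ?thesis
      by blast
  qed
  then obtain G where G: "\<And>\<gamma>. \<gamma> \<in> elts \<kappa> \<Longrightarrow>
      G \<gamma> \<in> elts \<kappa> \<and> \<gamma> \<in> elts (G \<gamma>) \<and> X \<gamma> \<inter> elts \<kappa> \<subseteq> elts (G \<gamma>)"
    by metis
  have "club_in {\<delta> \<in> elts \<kappa>. elts \<delta> \<noteq> {} \<and> (\<forall>\<gamma>\<in>elts \<delta>. G \<gamma> \<in> elts \<delta>)} \<kappa>"
    using G by (intro club_in_closure_points[OF reg unc]) auto
  then have "{\<alpha> \<in> elts \<kappa>. elts (d \<alpha>) = elts D \<inter> elts \<alpha>} \<inter>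
      {\<delta> \<in> elts \<kappa>. elts \<delta> \<noteq> {} \<and> (\<forall>\<gamma>\<in>elts \<delta>. G \<gamma> \<in> elts \<delta>)} \<noteq> {}"
    using stat unfolding stationary_in_def by blast
  then obtain \<beta> where \<beta>: "\<beta> \<in> elts \<kappa>" "elts (d \<beta>) = elts D \<inter> elts \<beta>" "elts \<beta> \<noteq> {}"
    and closed: "\<And>\<gamma>. \<gamma> \<in> elts \<beta> \<Longrightarrow> G \<gamma> \<in> elts \<beta>"
    by blast
  have ord\<beta>: "ordinal \<beta>" and \<beta>\<kappa>: "elts \<beta> \<subseteq> elts \<kappa>"
    using ordinal_elt[OF ord \<beta>(1)] ordinal_trans[OF ord \<beta>(1)] by auto

  have "elts \<beta> \<union> P \<subseteq> X \<beta>"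
    unfolding X_def by (rule subset_skolem_hull)
  then have \<beta>X: "elts \<beta> \<subseteq> X \<beta>" and PX: "\<kappa> \<in> X \<beta>" "D \<in> X \<beta>" "seq \<kappa> d \<in> X \<beta>"
    by (auto simp: P_def)
  have "X \<beta> \<inter> elts \<kappa> \<subseteq> elts \<beta>"
  proof
    fix \<xi>
    assume \<xi>: "\<xi> \<in> X \<beta> \<inter> elts \<kappa>"
    \<comment> \<open>Since \<open>\<beta>\<close> is a limit, its hull is the union of the hulls of smaller ordinals.\<close>
    have "elts \<beta> \<union> P \<subseteq> (\<Union>\<gamma>\<in>elts \<beta>. elts \<gamma> \<union> P)"
    proof
      fix x
      assume "x \<in> elts \<beta> \<union> P"
      then show "x \<in> (\<Union>\<gamma>\<in>elts \<beta>. elts \<gamma> \<union> P)"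
        using closed[of x] G[of x] \<beta>(3) \<beta>\<kappa> by auto
    qed
    moreover have "(\<Union>\<gamma>\<in>elts \<beta>. elts \<gamma> \<union> P) \<subseteq> elts \<beta> \<union> P"
      using ordinal_trans[OF ord\<beta>] by auto
    ultimately have "elts \<beta> \<union> P = (\<Union>\<gamma>\<in>elts \<beta>. elts \<gamma> \<union> P)"
      by (rule subset_antisym)
    then have "X \<beta> = skolem_hull (H \<theta>) (\<Union>\<gamma>\<in>elts \<beta>. elts \<gamma> \<union> P)"
      unfolding X_def by (rule arg_cong)
    also have "\<dots> \<subseteq> (\<Union>\<gamma>\<in>elts \<beta>. X \<gamma>)"
      unfolding X_def
    proof (rule skolem_hull_directed_UN[OF \<beta>(3)])
      fix \<gamma> \<gamma>'
      assume *: "\<gamma> \<in> elts \<beta>" "\<gamma>' \<in> elts \<beta>"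
      then obtain \<delta> where "\<delta> \<in> {\<gamma>, \<gamma>'}" "\<And>\<xi>. \<xi> \<in> {\<gamma>, \<gamma>'} \<Longrightarrow> elts \<xi> \<subseteq> elts \<delta>"
        using ordinal_elt_finite_bound[OF ord\<beta>, of "{\<gamma>, \<gamma>'}"] by auto
      then show "\<exists>\<delta>\<in>elts \<beta>. (elts \<gamma> \<union> P) \<union> (elts \<gamma>' \<union> P) \<subseteq> elts \<delta> \<union> P"
        using * by (intro bexI[of _ \<delta>]) auto
    qed
    finally obtain \<gamma> where \<gamma>: "\<gamma> \<in> elts \<beta>" "\<xi> \<in> X \<gamma>"
      using \<xi> by blast
    then have "\<xi> \<in> elts (G \<gamma>)"
      using G[of \<gamma>] \<beta>\<kappa> \<xi> by blast
    then show "\<xi> \<in> elts \<beta>"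
      using closed[OF \<gamma>(1)] ordinal_trans[OF ord\<beta>] by blast
  qed
  then have X\<kappa>: "X \<beta> \<inter> elts \<kappa> = elts \<beta>"
    using \<beta>X \<beta>\<kappa> by blast
  obtain \<mu> where \<mu>: "\<mu> \<in> elts \<kappa>" "X \<beta> \<lesssim> elts \<mu>"
    using size[OF \<beta>(1)] by blast
  have "small (X \<beta>)"
  proof -
    obtain g where "X \<beta> \<subseteq> g ` elts \<mu>"
      using \<mu>(2) unfolding lepoll_iff by (elim exE)
    then show ?thesis
      using small_subset[OF small_image[OF small_elts]] by blast
  qed
  moreover have "elementary_embedding (\<lambda>x. x) (X \<beta>) (H \<theta>)"
    unfolding X_def
  proof (rule elementary_skolem_hull)
    have "elts \<kappa> \<subseteq> H \<theta>"
      using P transitive_class_H[of \<theta>] by (auto simp: P_def transitive_class_def)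
    then show "elts \<beta> \<union> P \<subseteq> H \<theta>"
      using P \<beta>\<kappa> by blast
  qed
  ultimately obtain M \<pi> where M: "transitive M" "elts M = \<pi> ` X \<beta>" and inj: "inj_on \<pi> (X \<beta>)"
    and elem: "elementary_embedding (inv_into (X \<beta>) \<pi>) (elts M) (H \<theta>)"
    and \<pi>: "\<And>x. x \<in> X \<beta> \<Longrightarrow> elts (\<pi> x) = \<pi> ` (X \<beta> \<inter> elts x)"
    using transitive_collapse[OF _ transitive_class_H] by metis

  have \<pi>_id: "\<pi> \<gamma> = \<gamma>" if "\<gamma> \<in> elts \<beta>" for \<gamma>
    using that
  proof (induction \<gamma> rule: mem_induct)
    case (less \<gamma>)
    have sub: "elts \<gamma> \<subseteq> elts \<beta>"
      using ordinal_trans[OF ord\<beta> less.prems] by blast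
    have "elts (\<pi> \<gamma>) = \<pi> ` (X \<beta> \<inter> elts \<gamma>)"
      using less.prems \<beta>X by (intro \<pi>) blast
    also have "X \<beta> \<inter> elts \<gamma> = elts \<gamma>"
      using sub \<beta>X by blast
    also have "\<pi> ` elts \<gamma> = elts \<gamma>"
      using less.IH sub by (simp add: subset_iff)
    finally show ?case
      by (rule extensionality)
  qed
  then have \<pi>_image: "\<pi> ` A = A" if "A \<subseteq> elts \<beta>" for A
    using that by (simp add: subset_iff)
  have "\<pi> \<kappa> = \<beta>"
    using \<pi>[OF PX(1)] X\<kappa> \<pi>_image[of "elts \<beta>"] by (intro extensionality) simp
  have "X \<beta> \<inter> elts D = elts D \<inter> elts \<beta>"
    using X\<kappa> D by blast
  then have "\<pi> D = d \<beta>"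
    using \<pi>[OF PX(2)] \<pi>_image[of "elts D \<inter> elts \<beta>"] \<beta>(2) by (intro extensionality) simp
  define j where "j = inv_into (X \<beta>) \<pi>"
  have j: "j (\<pi> x) = x" if "x \<in> X \<beta>" for x
    using inj that by (simp add: j_def)
  have j\<beta>: "j \<beta> = \<kappa>"
    using j[OF PX(1)] \<open>\<pi> \<kappa> = \<beta>\<close> by simp
  have j_id: "j \<gamma> = \<gamma>" if "\<gamma> \<in> elts \<beta>" for \<gamma>
    using j[of \<gamma>] \<beta>X that \<pi>_id[OF that] by auto
  have moved: "moved j (elts M) \<beta>"
    unfolding moved_def j\<beta> using ord\<beta> \<beta>(1) PX(1) \<open>\<pi> \<kappa> = \<beta>\<close> M(2) by blast
  then have crit: "crit j (elts M) = \<beta>"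
    using j_id by (rule crit_eqI)
  have "M \<in> H \<theta>"
  proof (rule in_H[OF order_refl transitive_class_elts[OF M(1)]])
    have "elts M \<lesssim> X \<beta>"
      unfolding M(2) by (rule image_lepoll)
    also note \<mu>(2)
    also have "elts \<mu> \<prec> elts \<kappa>"
      using card \<mu>(1) by (rule cardinal_elt_lesspoll)
    also have "elts \<kappa> \<prec> elts \<theta>"
      using \<theta> by (rule cardinal_elt_lesspoll)
    finally show "elts M \<prec> elts \<theta>" .
  qed
  then have "small_embedding \<kappa> \<theta> M j"
    unfolding small_embedding_def crit nontrivial_def
    using card \<theta> M(1) elem moved j\<beta> unfolding j_def by blast
  moreover have "seq \<kappa> d \<in> j ` elts M"
    using j[OF PX(3)] PX(3) unfolding M(2) by (metis image_eqI)
  moreover have "d (crit j (elts M)) \<in> elts M"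
    unfolding crit unfolding M(2) \<open>\<pi> D = d \<beta>\<close>[symmetric] using PX(2) by (rule imageI)
  ultimately show ?thesis
    by blast
qed


section \<open>Formulas\<close>

definition fm_imp :: "fm \<Rightarrow> fm \<Rightarrow> fm" where
  "fm_imp p q = Neg (Conj p (Neg q))"

definition fm_iff :: "fm \<Rightarrow> fm \<Rightarrow> fm" where
  "fm_iff p q = Conj (fm_imp p q) (fm_imp q p)"

definition fm_ex :: "nat \<Rightarrow> fm \<Rightarrow> fm" where
  "fm_ex n p = Neg (All n (Neg p))"

lemma sat_fm_imp [simp]: "sat N (fm_imp p q) s \<longleftrightarrow> (sat N p s \<longrightarrow> sat N q s)"
  by (simp add: fm_imp_def)

lemma sat_fm_iff [simp]: "sat N (fm_iff p q) s \<longleftrightarrow> (sat N p s \<longleftrightarrow> sat N q s)"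
  by (auto simp: fm_iff_def)

lemma sat_fm_ex [simp]: "sat N (fm_ex n p) s \<longleftrightarrow> (\<exists>x\<in>N. sat N p (s(n := x)))"
  by (simp add: fm_ex_def)

lemma transitive_class_ball:
  "transitive_class N \<Longrightarrow> a \<in> N \<Longrightarrow> (\<forall>x\<in>N. x \<in> elts a \<longrightarrow> P x) \<longleftrightarrow> (\<forall>x\<in>elts a. P x)"
  by (auto dest: transitive_classD)

lemma transitive_class_bex:
  "transitive_class N \<Longrightarrow> a \<in> N \<Longrightarrow> (\<exists>x\<in>N. x \<in> elts a \<and> P x) \<longleftrightarrow> (\<exists>x\<in>elts a. P x)"
  by (auto dest: transitive_classD)

definition fm_ordinal :: fm where
  "fm_ordinal = All 1 (fm_imp (Mem 1 0) (All 2 (fm_imp (Mem 2 1)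
     (Conj (Mem 2 0) (All 3 (fm_imp (Mem 3 2) (Mem 3 1)))))))"

lemma sat_fm_ordinal:
  assumes "transitive_class N" "s 0 \<in> N"
  shows "sat N fm_ordinal s \<longleftrightarrow> ordinal (s 0)"
proof -
  have sub: "y \<in> N" if "y \<in> elts x" "x \<in> N" for x y
    using transitive_classD[OF assms(1)] that by blast
  have "sat N fm_ordinal s \<longleftrightarrow>
      (\<forall>x\<in>N. x \<in> elts (s 0) \<longrightarrow> (\<forall>y\<in>N. y \<in> elts x \<longrightarrow>
         y \<in> elts (s 0) \<and> (\<forall>z\<in>N. z \<in> elts y \<longrightarrow> z \<in> elts x)))"
    by (simp add: fm_ordinal_def)
  also have "\<dots> \<longleftrightarrow> (\<forall>x\<in>elts (s 0). \<forall>y\<in>elts x. y \<in> elts (s 0) \<and> (\<forall>z\<in>elts y. z \<in> elts x))"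
    using sub assms(2) by (simp add: transitive_class_ball[OF assms(1)] cong: ball_cong)
  also have "\<dots> \<longleftrightarrow> ordinal (s 0)"
    unfolding ordinal_def transitive_def by blast
  finally show ?thesis .
qed

text \<open>This says \<open>u = {a, b}\<close>; the variable \<open>w\<close> is bound.\<close>

definition fm_doubleton :: "nat \<Rightarrow> nat \<Rightarrow> nat \<Rightarrow> nat \<Rightarrow> fm" where
  "fm_doubleton w u a b = All w (fm_iff (Mem w u) (Neg (Conj (Neg (Eq w a)) (Neg (Eq w b)))))"

lemma sat_fm_doubleton:
  assumes N: "transitive_class N" and s: "s u \<in> N" "s a \<in> N" "s b \<in> N"
    and w: "w \<noteq> u" "w \<noteq> a" "w \<noteq> b"
  shows "sat N (fm_doubleton w u a b) s \<longleftrightarrow> s u = set_of {s a, s b}"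
proof -
  have "sat N (fm_doubleton w u a b) s \<longleftrightarrow> (\<forall>x\<in>N. x \<in> elts (s u) \<longleftrightarrow> x = s a \<or> x = s b)"
    using w by (auto simp: fm_doubleton_def)
  also have "\<dots> \<longleftrightarrow> elts (s u) = {s a, s b}"
    using s transitive_classD[OF N s(1)] by auto
  also have "\<dots> \<longleftrightarrow> s u = set_of {s a, s b}"
    using elts_inject[of "s u" "set_of {s a, s b}"] by simp
  finally show ?thesis .
qed

text \<open>
  The formula says that the pair of the variables \<open>x\<close> and \<open>y\<close> is in \<open>f\<close>. Its bound variables
  start at 10.
\<close>

definition fm_app :: "nat \<Rightarrow> nat \<Rightarrow> nat \<Rightarrow> fm" where
  "fm_app f x y = fm_ex 10 (Conj (Mem 10 f) (fm_ex 11 (fm_ex 12 (Conj (fm_doubleton 13 11 x x)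
     (Conj (fm_doubleton 13 12 x y) (fm_doubleton 13 10 11 12))))))"

lemma sat_fm_app:
  assumes N: "transitive_class N" and s: "s f \<in> N" "s x \<in> N" "s y \<in> N"
    and vars: "f < 10" "x < 10" "y < 10"
  shows "sat N (fm_app f x y) s \<longleftrightarrow> kpair (s x) (s y) \<in> elts (s f)"
proof -
  have "sat N (fm_app f x y) s \<longleftrightarrow>
      (\<exists>z\<in>N. z \<in> elts (s f) \<and> (\<exists>u\<in>N. \<exists>v\<in>N. u = set_of {s x, s x} \<and> v = set_of {s x, s y} \<and>
         z = set_of {u, v}))"
    unfolding fm_app_def sat_fm_ex sat.simps
    using s vars by (intro bex_cong conj_cong refl) (auto simp: sat_fm_doubleton[OF N])
  also have "\<dots> \<longleftrightarrow> kpair (s x) (s y) \<in> elts (s f)"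
  proof
    assume pair: "kpair (s x) (s y) \<in> elts (s f)"
    then have "kpair (s x) (s y) \<in> N"
      using transitive_classD[OF N s(1)] by blast
    moreover from this have "set_of {s x, s x} \<in> N" "set_of {s x, s y} \<in> N"
      using transitive_classD[OF N, of "kpair (s x) (s y)"] by (auto simp: kpair_def)
    ultimately show "\<exists>z\<in>N. z \<in> elts (s f) \<and> (\<exists>u\<in>N. \<exists>v\<in>N. u = set_of {s x, s x} \<and>
        v = set_of {s x, s y} \<and> z = set_of {u, v})"
      using pair by (auto simp: kpair_def)
  qed (auto simp: kpair_def)
  finally show ?thesis .
qed

lemma set_of_inject: "small A \<Longrightarrow> small B \<Longrightarrow> set_of A = set_of B \<longleftrightarrow> A = B"
  by (metis elts_set_of)

lemma kpair_inject [simp]: "kpair a b = kpair c d \<longleftrightarrow> a = c \<and> b = d"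
  by (auto simp: kpair_def set_of_inject doubleton_eq_iff)

lemma kpair_in_seq_iff: "kpair x y \<in> elts (seq A f) \<longleftrightarrow> x \<in> elts A \<and> y = f x"
  by (auto simp: elts_seq)


section \<open>Elementary embeddings between transitive classes\<close>

lemma elementary_embedding_in: "elementary_embedding j M N \<Longrightarrow> x \<in> M \<Longrightarrow> j x \<in> N"
  unfolding elementary_embedding_def by blast

lemma elementary_embedding_sat:
  assumes "elementary_embedding j M N" "range s \<subseteq> M"
  shows "sat M p s \<longleftrightarrow> sat N p (j \<circ> s)"
  using assms unfolding elementary_embedding_def by blast

lemma elementary_embedding_mem_iff:
  assumes "elementary_embedding j M N" "x \<in> M" "y \<in> M"
  shows "j x \<in> elts (j y) \<longleftrightarrow> x \<in> elts y"
  using elementary_embedding_sat[OF assms(1), of "(\<lambda>i. x)(1 := y)" "Mem 0 1"] assms(2,3) by auto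

lemma elementary_embedding_inject:
  assumes "elementary_embedding j M N" "x \<in> M" "y \<in> M"
  shows "j x = j y \<longleftrightarrow> x = y"
  using elementary_embedding_sat[OF assms(1), of "(\<lambda>i. x)(1 := y)" "Eq 0 1"] assms(2,3) by auto

lemma elementary_embedding_ordinal:
  assumes "elementary_embedding j M N" "transitive_class M" "transitive_class N" "x \<in> M"
  shows "ordinal (j x) \<longleftrightarrow> ordinal x"
  using elementary_embedding_sat[OF assms(1), of "\<lambda>i. x" fm_ordinal] assms
  by (simp add: sat_fm_ordinal elementary_embedding_in image_subset_iff)

lemma elementary_embedding_subset:
  assumes elem: "elementary_embedding j M N" and N: "transitive_class N"
    and xy: "x \<in> M" "y \<in> M" "elts x \<subseteq> elts y"
  shows "elts (j x) \<subseteq> elts (j y)"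
proof -
  let ?p = "All 2 (fm_imp (Mem 2 0) (Mem 2 1))" and ?s = "(\<lambda>i::nat. x)(1 := y)"
  have "sat M ?p ?s"
    using xy(3) by auto
  moreover have "range ?s \<subseteq> M"
    using xy by auto
  ultimately have "sat N ?p (j \<circ> ?s)"
    using elementary_embedding_sat[OF elem] by blast
  then show ?thesis
    using transitive_classD[OF N elementary_embedding_in[OF elem xy(1)]] by auto
qed

lemma elementary_embedding_kpair:
  assumes elem: "elementary_embedding j M N" and M: "transitive_class M" and N: "transitive_class N"
    and x: "f \<in> M" "x \<in> M" "y \<in> M"
  shows "kpair (j x) (j y) \<in> elts (j f) \<longleftrightarrow> kpair x y \<in> elts f"
proof -
  let ?s = "(\<lambda>i::nat. f)(1 := x, 2 := y)"
  have s: "range ?s \<subseteq> M"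
    using x by auto
  have "sat M (fm_app 0 1 2) ?s \<longleftrightarrow> sat N (fm_app 0 1 2) (j \<circ> ?s)"
    using s by (rule elementary_embedding_sat[OF elem])
  then show ?thesis
    using x elementary_embedding_in[OF elem] by (simp add: sat_fm_app[OF M] sat_fm_app[OF N])
qed

text \<open>
  If \<open>\<gamma>\<close> is below the least moved ordinal \<open>\<beta>\<close> then \<open>j \<gamma> \<le> \<gamma>\<close>. If \<open>j \<gamma> = \<delta> < \<gamma>\<close>, then
  inductively \<open>j \<delta> = \<delta> = j \<gamma>\<close>, against injectivity.
\<close>

lemma small_embedding_crit:
  fixes \<kappa> :: "'v::zfc_universe"
  assumes emb: "small_embedding \<kappa> \<theta> M j"
  defines "\<beta> \<equiv> crit j (elts M)"
  shows "ordinal \<beta>" "\<beta> \<in> elts M" "\<beta> \<in> elts \<kappa>" "j \<beta> = \<kappa>"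
    and "\<And>\<gamma>. \<gamma> \<in> elts \<beta> \<Longrightarrow> j \<gamma> = \<gamma>"
proof -
  have elem: "elementary_embedding j (elts M) (H \<theta>)" and M: "transitive_class (elts M)"
    and nontriv: "nontrivial j (elts M)"
    using emb by (simp_all add: small_embedding_def transitive_class_elts)
  have "\<exists>\<alpha>. moved j (elts M) \<alpha> \<and> (\<forall>\<gamma>\<in>elts \<alpha>. \<not> moved j (elts M) \<gamma>)"
    using nontriv mem_minimal[of "moved j (elts M)"] unfolding nontrivial_def by blast
  then obtain \<alpha> where \<alpha>: "moved j (elts M) \<alpha>"
    and min: "\<And>\<gamma>. \<gamma> \<in> elts \<alpha> \<Longrightarrow> \<not> moved j (elts M) \<gamma>"
    by blast
  have ord: "ordinal \<alpha>" and \<alpha>M: "\<alpha> \<in> elts M"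
    using \<alpha> by (simp_all add: moved_def)
  have fixed: "j \<gamma> = \<gamma>" if "\<gamma> \<in> elts \<alpha>" for \<gamma>
    using that
  proof (induction \<gamma> rule: mem_induct)
    case (less \<gamma>)
    have \<gamma>: "ordinal \<gamma>" "\<gamma> \<in> elts M"
      using ordinal_elt[OF ord less.prems] transitive_classD[OF M \<alpha>M less.prems] by auto
    have "ordinal (j \<gamma>)"
      using elementary_embedding_ordinal[OF elem M transitive_class_H] \<gamma> by blast
    moreover have "\<gamma> \<notin> elts (j \<gamma>)"
      using min[OF less.prems] \<gamma> by (simp add: moved_def)
    moreover have "j \<gamma> \<notin> elts \<gamma>"
    proof
      assume *: "j \<gamma> \<in> elts \<gamma>"
      then have "j (j \<gamma>) = j \<gamma>"
        using less.IH ordinal_trans[OF ord less.prems] by blast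
      then have "j \<gamma> = \<gamma>"
        using elementary_embedding_inject[OF elem transitive_classD[OF M \<gamma>(2) *] \<gamma>(2)] by blast
      then show False
        using * mem_irrefl[of \<gamma>] by simp
    qed
    ultimately show ?case
      using ordinal_linear[OF _ \<gamma>(1), of "j \<gamma>"] by blast
  qed
  have "\<beta> = \<alpha>"
    unfolding \<beta>_def using \<alpha> fixed by (rule crit_eqI)
  moreover have "j \<beta> = \<kappa>"
    using emb by (simp add: small_embedding_def \<beta>_def)
  ultimately show "ordinal \<beta>" "\<beta> \<in> elts M" "\<beta> \<in> elts \<kappa>" "j \<beta> = \<kappa>"
    and "\<And>\<gamma>. \<gamma> \<in> elts \<beta> \<Longrightarrow> j \<gamma> = \<gamma>"
    using \<alpha> fixed by (auto simp: moved_def)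
qed


section \<open>Ineffability from small embeddings\<close>

text \<open>
  The critical point is a nonzero limit ordinal because \<open>0\<close> and successors of fixed ordinals are
  fixed.
\<close>

lemma small_embedding_crit_infinite:
  fixes \<kappa> :: "'v::zfc_universe"
  assumes emb: "small_embedding \<kappa> \<theta> M j"
  shows "infinite (elts (crit j (elts M)))"
proof -
  define \<beta> where "\<beta> = crit j (elts M)"
  note crit = small_embedding_crit[OF emb, folded \<beta>_def]
  have elem: "elementary_embedding j (elts M) (H \<theta>)" and M: "transitive_class (elts M)"
    using emb by (simp_all add: small_embedding_def transitive_class_elts)
  have \<kappa>H: "\<kappa> \<in> H \<theta>"
    using elementary_embedding_in[OF elem crit(2)] crit(4) by simp
  have \<beta>H: "\<beta> \<in> H \<theta>"
    using transitive_classD[OF transitive_class_H \<kappa>H crit(3)] .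
  have "elts \<beta> \<noteq> {}"
  proof
    assume "elts \<beta> = {}"
    then have "sat (elts M) (All 1 (Neg (Mem 1 0))) (\<lambda>i. \<beta>)"
      by simp
    then have "sat (H \<theta>) (All 1 (Neg (Mem 1 0))) (j \<circ> (\<lambda>i. \<beta>))"
      using elementary_embedding_sat[OF elem, of "\<lambda>i. \<beta>"] crit(2) by blast
    then show False
      using crit(3,4) \<beta>H by simp
  qed
  moreover have "\<exists>\<gamma>\<in>elts \<beta>. \<delta> \<in> elts \<gamma>" if \<delta>: "\<delta> \<in> elts \<beta>" for \<delta>
  proof (rule ccontr)
    assume *: "\<not> (\<exists>\<gamma>\<in>elts \<beta>. \<delta> \<in> elts \<gamma>)"
    let ?p = "All 2 (fm_imp (Mem 2 0) (Neg (Mem 1 2)))" and ?s = "(\<lambda>i::nat. \<beta>)(1 := \<delta>)"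
    have "sat (elts M) ?p ?s"
      using * by auto
    moreover have "range ?s \<subseteq> elts M"
      using crit(2) transitive_classD[OF M crit(2) \<delta>] by auto
    ultimately have "sat (H \<theta>) ?p (j \<circ> ?s)"
      using elementary_embedding_sat[OF elem] by blast
    then show False
      using crit(3,4) crit(5)[OF \<delta>] \<beta>H \<delta> by simp
  qed
  ultimately show ?thesis
    unfolding \<beta>_def[symmetric]
    using ordinal_elt_finite_bound[OF crit(1), of "elts \<beta>"] mem_irrefl by (metis order_refl subsetD)
qed

lemma small_embedding_imp_uncountable:
  assumes "small_embedding \<kappa> \<theta> M j"
  shows "uncountable (elts \<kappa>)"
proof
  assume "countable (elts \<kappa>)"
  then have "elts \<kappa> \<lesssim> elts (crit j (elts M))"
    using small_embedding_crit_infinite[OF assms] by (rule countable_lepoll_infinite)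
  also have "\<dots> \<prec> elts \<kappa>"
    using assms small_embedding_crit(3)[OF assms]
    by (intro cardinal_elt_lesspoll) (simp_all add: small_embedding_def)
  finally show False
    by simp
qed

text \<open>
  The variables 0, 1, 2 stand for \<open>\<kappa>\<close>, \<open>\<alpha>\<close> and a set of pairs that is a function from
  \<open>\<alpha>\<close> to \<open>\<kappa>\<close> with unbounded range.
\<close>

definition fm_cofinal_map :: fm where
  "fm_cofinal_map = Conj (Mem 1 0)
     (Conj (All 3 (fm_imp (Mem 3 1) (fm_ex 4 (Conj (Mem 4 0) (fm_app 2 3 4)))))
     (Conj (All 3 (fm_imp (Mem 3 1) (All 4 (All 5 (fm_imp (Conj (fm_app 2 3 4) (fm_app 2 3 5)) (Eq 4 5))))))
           (All 3 (fm_imp (Mem 3 0) (fm_ex 4 (Conj (Mem 4 1) (fm_ex 5 (Conj (fm_app 2 4 5) (Neg (Mem 5 3))))))))))"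

text \<open>
  In a transitive class, quantifiers bounded by a member are absolute. The values \<open>\<eta>\<close> and \<open>\<zeta>\<close> of the
  map are only known to be in \<open>N\<close>.
\<close>

lemma sat_fm_cofinal_map:
  assumes N: "transitive_class N" and s: "s 0 \<in> N" "s 1 \<in> N" "s 2 \<in> N"
  shows "sat N fm_cofinal_map s \<longleftrightarrow> s 1 \<in> elts (s 0) \<and>
    (\<forall>\<xi>\<in>elts (s 1). \<exists>\<eta>\<in>elts (s 0). kpair \<xi> \<eta> \<in> elts (s 2)) \<and>
    (\<forall>\<xi>\<in>elts (s 1). \<forall>\<eta>\<in>N. \<forall>\<zeta>\<in>N.
       kpair \<xi> \<eta> \<in> elts (s 2) \<and> kpair \<xi> \<zeta> \<in> elts (s 2) \<longrightarrow> \<eta> = \<zeta>) \<and>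
    (\<forall>\<gamma>\<in>elts (s 0). \<exists>\<xi>\<in>elts (s 1). \<exists>\<eta>\<in>N. kpair \<xi> \<eta> \<in> elts (s 2) \<and> \<eta> \<notin> elts \<gamma>)"
proof -
  note all = transitive_class_ball[OF N] and ex = transitive_class_bex[OF N]
  have in_N: "x \<in> N" if "x \<in> elts (s 0) \<or> x \<in> elts (s 1)" for x
    using transitive_classD[OF N] s that by blast
  show ?thesis
    unfolding fm_cofinal_map_def
    using s by (simp add: sat_fm_app[OF N] all ex in_N cong: ball_cong bex_cong)
qed

text \<open>
  A cofinal map from some \<open>\<alpha> < \<kappa>\<close> would be reflected to a cofinal map \<open>f\<close> in \<open>M\<close> from some
  \<open>\<alpha> < \<beta>\<close> to the critical point \<open>\<beta>\<close>. Since \<open>j\<close> fixes \<open>\<alpha>\<close>, its elements and the values of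
  \<open>f\<close>, the values of \<open>j f\<close> stay below \<open>\<beta>\<close>.
\<close>

lemma small_embedding_imp_regular:
  fixes \<kappa> :: "'v::zfc_universe"
  assumes emb: "small_embedding \<kappa> \<theta> M j"
    and seq: "\<And>\<alpha> f. \<alpha> \<in> elts \<kappa> \<Longrightarrow> f ` elts \<alpha> \<subseteq> elts \<kappa> \<Longrightarrow> seq \<alpha> f \<in> H \<theta>"
  shows "regular \<kappa>"
proof -
  define \<beta> where "\<beta> = crit j (elts M)"
  note crit = small_embedding_crit[OF emb, folded \<beta>_def]
  have card: "cardinal \<kappa>" and elem: "elementary_embedding j (elts M) (H \<theta>)"
    and M: "transitive_class (elts M)"
    using emb by (simp_all add: small_embedding_def transitive_class_elts)
  note H = transitive_class_H[of \<theta>]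
  have \<kappa>H: "\<kappa> \<in> H \<theta>"
    using elementary_embedding_in[OF elem crit(2)] crit(4) by simp
  have no_cofinal: False if \<alpha>: "\<alpha> \<in> elts \<kappa>" and f: "f ` elts \<alpha> \<subseteq> elts \<kappa>"
    and unb: "\<forall>\<gamma>\<in>elts \<kappa>. \<exists>\<xi>\<in>elts \<alpha>. f \<xi> \<notin> elts \<gamma>" for \<alpha> f
  proof -
    have \<alpha>H: "\<alpha> \<in> H \<theta>" and fH: "seq \<alpha> f \<in> H \<theta>"
      using transitive_classD[OF H \<kappa>H \<alpha>] seq[OF \<alpha> f] .
    have "f \<xi> \<in> H \<theta>" if "\<xi> \<in> elts \<alpha>" for \<xi>
      using transitive_classD[OF H \<kappa>H] f that by blast
    then have "sat (H \<theta>) fm_cofinal_map ((\<lambda>i. \<kappa>)(1 := \<alpha>, 2 := seq \<alpha> f))"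
      using \<alpha> f unb \<kappa>H \<alpha>H fH
      by (subst sat_fm_cofinal_map[OF H]) (auto simp: kpair_in_seq_iff)
    then have "sat (H \<theta>) (fm_ex 1 (fm_ex 2 fm_cofinal_map)) (j \<circ> (\<lambda>i. \<beta>))"
      using \<alpha>H fH crit(4) by (auto simp: comp_def)
    then have "sat (elts M) (fm_ex 1 (fm_ex 2 fm_cofinal_map)) (\<lambda>i. \<beta>)"
      using elementary_embedding_sat[OF elem, of "\<lambda>i. \<beta>"] crit(2) by blast
    then obtain \<alpha>' g where \<alpha>': "\<alpha>' \<in> elts M" and g: "g \<in> elts M"
      and sat: "sat (elts M) fm_cofinal_map ((\<lambda>i. \<beta>)(1 := \<alpha>', 2 := g))"
      by auto
    have "sat (H \<theta>) fm_cofinal_map (j \<circ> (\<lambda>i. \<beta>)(1 := \<alpha>', 2 := g))"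
      using elementary_embedding_sat[OF elem, of "(\<lambda>i. \<beta>)(1 := \<alpha>', 2 := g)"] sat \<alpha>' g crit(2)
      by auto
    moreover have jg: "j g \<in> H \<theta>" "j \<alpha>' \<in> H \<theta>"
      using elementary_embedding_in[OF elem] g \<alpha>' by auto
    ultimately have func: "\<And>\<xi> \<eta> \<zeta>. \<xi> \<in> elts (j \<alpha>') \<Longrightarrow> \<eta> \<in> H \<theta> \<Longrightarrow> \<zeta> \<in> H \<theta> \<Longrightarrow>
        kpair \<xi> \<eta> \<in> elts (j g) \<Longrightarrow> kpair \<xi> \<zeta> \<in> elts (j g) \<Longrightarrow> \<eta> = \<zeta>"
      and unb': "\<And>\<gamma>. \<gamma> \<in> elts \<kappa> \<Longrightarrow>
        \<exists>\<xi>\<in>elts (j \<alpha>'). \<exists>\<eta>\<in>H \<theta>. kpair \<xi> \<eta> \<in> elts (j g) \<and> \<eta> \<notin> elts \<gamma>"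
      using \<kappa>H crit(4) by (simp_all add: sat_fm_cofinal_map[OF H])
    have \<alpha>'\<beta>: "\<alpha>' \<in> elts \<beta>"
      and total: "\<And>\<xi>. \<xi> \<in> elts \<alpha>' \<Longrightarrow> \<exists>\<eta>\<in>elts \<beta>. kpair \<xi> \<eta> \<in> elts g"
      using sat \<alpha>' g crit(2) by (simp_all add: sat_fm_cofinal_map[OF M])
    obtain \<xi> \<eta> where \<xi>: "\<xi> \<in> elts \<alpha>'" and \<eta>: "\<eta> \<in> H \<theta>" "kpair \<xi> \<eta> \<in> elts (j g)" "\<eta> \<notin> elts \<beta>"
      using unb'[OF crit(3)] crit(5)[OF \<alpha>'\<beta>] by auto
    have \<xi>\<beta>: "\<xi> \<in> elts \<beta>"
      using ordinal_trans[OF crit(1) \<alpha>'\<beta> \<xi>] .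
    obtain \<zeta> where \<zeta>: "\<zeta> \<in> elts \<beta>" "kpair \<xi> \<zeta> \<in> elts g"
      using total[OF \<xi>] by blast
    have in_M: "\<xi> \<in> elts M" "\<zeta> \<in> elts M"
      using transitive_classD[OF M crit(2)] \<xi>\<beta> \<zeta>(1) by auto
    have "kpair (j \<xi>) (j \<zeta>) \<in> elts (j g)"
      using elementary_embedding_kpair[OF elem M H g in_M] \<zeta>(2) by simp
    moreover have "j \<zeta> \<in> H \<theta>"
      using elementary_embedding_in[OF elem in_M(2)] .
    ultimately have "\<eta> = \<zeta>"
      using func[of \<xi> \<eta> \<zeta>] \<xi> \<eta> crit(5)[OF \<alpha>'\<beta>] crit(5)[OF \<xi>\<beta>] crit(5)[OF \<zeta>(1)] by simp
    then show False
      using \<eta>(3) \<zeta>(1) by simp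
  qed
  have "\<exists>\<gamma>\<in>elts \<kappa>. \<forall>\<xi>\<in>elts \<alpha>. f \<xi> \<in> elts \<gamma>"
    if "\<alpha> \<in> elts \<kappa>" "f ` elts \<alpha> \<subseteq> elts \<kappa>" for \<alpha> f
    using no_cofinal[OF that] by auto
  moreover have "infinite (elts \<kappa>)"
    using small_embedding_imp_uncountable[OF emb] by (auto dest: countable_finite)
  ultimately show ?thesis
    using card unfolding regular_def by simp
qed

text \<open>
  The variables 0 to 3 stand for \<open>\<kappa>\<close>, a \<open>\<kappa>\<close>-list, a set \<open>D\<close>, and a club in \<open>\<kappa>\<close> that contains
  no \<open>\<alpha>\<close> at which the list agrees with \<open>D\<close>.
\<close>

definition fm_club_disagreeing :: fm where
  "fm_club_disagreeing =
     Conj (All 4 (fm_imp (Mem 4 3) (Mem 4 0)))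
     (Conj (All 4 (fm_imp (Mem 4 0) (fm_ex 5 (Conj (Mem 5 3) (Mem 4 5)))))
     (Conj (All 4 (fm_imp (Mem 4 0) (fm_imp (Conj (fm_ex 5 (Mem 5 4))
              (All 5 (fm_imp (Mem 5 4) (fm_ex 6 (Conj (Mem 6 3) (Conj (Mem 6 4) (Mem 5 6))))))) (Mem 4 3))))
           (All 4 (fm_imp (Mem 4 3) (All 5 (fm_imp (fm_app 1 4 5)
              (Neg (All 6 (fm_iff (Mem 6 5) (Conj (Mem 6 2) (Mem 6 4)))))))))))"

lemma sat_fm_club_disagreeing:
  assumes N: "transitive_class N" and s: "s 0 \<in> N" "s 1 \<in> N" "s 2 \<in> N" "s 3 \<in> N"
  shows "sat N fm_club_disagreeing s \<longleftrightarrow> club_in (elts (s 3)) (s 0) \<and>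
    (\<forall>\<alpha>\<in>elts (s 3). \<forall>x\<in>N. kpair \<alpha> x \<in> elts (s 1) \<longrightarrow> elts x \<noteq> elts (s 2) \<inter> elts \<alpha>)"
proof -
  note all = transitive_class_ball[OF N] and ex = transitive_class_bex[OF N]
  have ex': "(\<exists>x\<in>N. x \<in> elts a) \<longleftrightarrow> elts a \<noteq> {}" if "a \<in> N" for a
    using transitive_classD[OF N that] by blast
  have eq: "(\<forall>y\<in>N. y \<in> elts x \<longleftrightarrow> y \<in> elts b \<and> y \<in> elts \<alpha>) \<longleftrightarrow> elts x = elts b \<inter> elts \<alpha>"
    if "x \<in> N" "\<alpha> \<in> N" for x b \<alpha>
    using transitive_classD[OF N that(1)] transitive_classD[OF N that(2)] by blast
  have in_N: "x \<in> N" if "x \<in> elts (s 0) \<or> x \<in> elts (s 3)" for x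
    using transitive_classD[OF N] s that by blast
  have "sat N fm_club_disagreeing s \<longleftrightarrow>
      (\<forall>x\<in>elts (s 3). x \<in> elts (s 0)) \<and>
      (\<forall>x\<in>elts (s 0). \<exists>y\<in>elts (s 3). x \<in> elts y) \<and>
      (\<forall>x\<in>elts (s 0). elts x \<noteq> {} \<and> (\<forall>y\<in>elts x. \<exists>z\<in>elts (s 3). z \<in> elts x \<and> y \<in> elts z) \<longrightarrow>
         x \<in> elts (s 3)) \<and>
      (\<forall>\<alpha>\<in>elts (s 3). \<forall>x\<in>N. kpair \<alpha> x \<in> elts (s 1) \<longrightarrow> elts x \<noteq> elts (s 2) \<inter> elts \<alpha>)"
    unfolding fm_club_disagreeing_def
    using s by (simp add: sat_fm_app[OF N] all ex ex' eq in_N cong: ball_cong bex_cong)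
  also have "\<dots> \<longleftrightarrow> club_in (elts (s 3)) (s 0) \<and>
      (\<forall>\<alpha>\<in>elts (s 3). \<forall>x\<in>N. kpair \<alpha> x \<in> elts (s 1) \<longrightarrow> elts x \<noteq> elts (s 2) \<inter> elts \<alpha>)"
    unfolding club_in_def unbounded_in_def by (auto simp: Bex_def Ball_def subset_iff) metis+
  finally show ?thesis .
qed

text \<open>
  The witness is \<open>D = j(d\<^sub>\<beta>)\<close> where \<open>\<beta>\<close> is the critical point, so that \<open>D \<inter> \<beta> = d\<^sub>\<beta>\<close>. If a club
  in \<open>\<kappa>\<close> avoided the points of agreement, then by elementarity so would one of the form \<open>j C\<close>. But
  \<open>j C \<inter> \<beta> = C\<close> is unbounded in \<open>\<beta>\<close>, so \<open>\<beta> \<in> j C\<close>, and \<open>\<beta>\<close> is a point of agreement.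
\<close>

lemma small_embedding_imp_stationary:
  fixes \<kappa> :: "'v::zfc_universe"
  assumes emb: "small_embedding \<kappa> \<theta> M j" and d: "list_on \<kappa> d"
    and ran: "seq \<kappa> d \<in> j ` elts M" and d_crit: "d (crit j (elts M)) \<in> elts M"
  defines "D \<equiv> j (d (crit j (elts M)))"
  shows "elts D \<subseteq> elts \<kappa>"
    and "stationary_in {\<alpha> \<in> elts \<kappa>. elts (d \<alpha>) = elts D \<inter> elts \<alpha>} \<kappa>"
proof -
  define \<beta> where "\<beta> = crit j (elts M)"
  note crit = small_embedding_crit[OF emb, folded \<beta>_def]
  have \<theta>: "cardinal \<theta>" "\<kappa> \<in> elts \<theta>" and elem: "elementary_embedding j (elts M) (H \<theta>)"
    and M: "transitive_class (elts M)"
    using emb by (simp_all add: small_embedding_def transitive_class_elts)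
  note H = transitive_class_H[of \<theta>]
  have d\<beta>M: "d \<beta> \<in> elts M" and D: "D = j (d \<beta>)"
    using d_crit by (simp_all add: D_def \<beta>_def)
  have \<kappa>H: "\<kappa> \<in> H \<theta>" and DH: "D \<in> H \<theta>"
    using elementary_embedding_in[OF elem crit(2)] elementary_embedding_in[OF elem d\<beta>M]
    by (simp_all add: crit(4) D)
  have d\<beta>: "elts (d \<beta>) \<subseteq> elts \<beta>"
    using d crit(3) by (simp add: list_on_def)
  show D\<kappa>: "elts D \<subseteq> elts \<kappa>"
    using elementary_embedding_subset[OF elem H d\<beta>M crit(2) d\<beta>] by (simp add: D crit(4))
  have reflect: "\<gamma> \<in> elts (j x) \<longleftrightarrow> \<gamma> \<in> elts x" if "\<gamma> \<in> elts \<beta>" "x \<in> elts M" for \<gamma> x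
    using elementary_embedding_mem_iff[OF elem transitive_classD[OF M crit(2) that(1)] that(2)]
      crit(5)[OF that(1)] by simp
  have agree: "elts (d \<beta>) = elts D \<inter> elts \<beta>"
    using reflect[OF _ d\<beta>M] d\<beta> unfolding D by blast
  obtain e where e: "e \<in> elts M" "j e = seq \<kappa> d"
    using ran by (metis imageE)
  have seqH: "seq \<kappa> d \<in> H \<theta>"
    using elementary_embedding_in[OF elem e(1)] e(2) by simp
  have "{\<alpha> \<in> elts \<kappa>. elts (d \<alpha>) = elts D \<inter> elts \<alpha>} \<inter> C \<noteq> {}" if C: "club_in C \<kappa>" for C
  proof
    assume disj: "{\<alpha> \<in> elts \<kappa>. elts (d \<alpha>) = elts D \<inter> elts \<alpha>} \<inter> C = {}"
    have C\<kappa>: "C \<subseteq> elts \<kappa>"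
      using C by (simp add: club_in_def)
    then have eltsC: "elts (set_of C) = C"
      by (intro elts_set_of small_subset[OF small_elts])
    then have CH: "set_of C \<in> H \<theta>"
      using C\<kappa> by (intro subset_of_elt_in_H[OF \<theta>]) simp
    have "elts x \<noteq> elts D \<inter> elts \<alpha>" if "\<alpha> \<in> C" "kpair \<alpha> x \<in> elts (seq \<kappa> d)" for \<alpha> x
      using disj C\<kappa> that by (auto simp: kpair_in_seq_iff)
    then have "sat (H \<theta>) fm_club_disagreeing ((\<lambda>i. \<kappa>)(1 := seq \<kappa> d, 2 := D, 3 := set_of C))"
      using C \<kappa>H seqH DH CH by (subst sat_fm_club_disagreeing[OF H]) (auto simp: eltsC)
    moreover have "j \<circ> (\<lambda>i::nat. \<beta>)(1 := e, 2 := d \<beta>) = (\<lambda>i. \<kappa>)(1 := seq \<kappa> d, 2 := D)"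
      using crit(4) e(2) D by auto
    ultimately have "sat (H \<theta>) (fm_ex 3 fm_club_disagreeing) (j \<circ> (\<lambda>i. \<beta>)(1 := e, 2 := d \<beta>))"
      using CH by auto
    moreover have "range ((\<lambda>i::nat. \<beta>)(1 := e, 2 := d \<beta>)) \<subseteq> elts M"
      using crit(2) e(1) d\<beta>M by auto
    ultimately have "sat (elts M) (fm_ex 3 fm_club_disagreeing) ((\<lambda>i. \<beta>)(1 := e, 2 := d \<beta>))"
      using elementary_embedding_sat[OF elem] by blast
    then obtain C' where C': "C' \<in> elts M"
      and sat: "sat (elts M) fm_club_disagreeing ((\<lambda>i. \<beta>)(1 := e, 2 := d \<beta>, 3 := C'))"
      by auto
    have "range ((\<lambda>i::nat. \<beta>)(1 := e, 2 := d \<beta>, 3 := C')) \<subseteq> elts M"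
      using crit(2) e(1) d\<beta>M C' by auto
    then have "sat (H \<theta>) fm_club_disagreeing (j \<circ> (\<lambda>i. \<beta>)(1 := e, 2 := d \<beta>, 3 := C'))"
      using elementary_embedding_sat[OF elem] sat by blast
    then have club: "club_in (elts (j C')) \<kappa>"
      and disagree: "\<And>\<alpha> x. \<alpha> \<in> elts (j C') \<Longrightarrow> x \<in> H \<theta> \<Longrightarrow> kpair \<alpha> x \<in> elts (seq \<kappa> d) \<Longrightarrow>
        elts x \<noteq> elts D \<inter> elts \<alpha>"
      using elementary_embedding_in[OF elem C'] \<kappa>H DH seqH crit(4) e(2) D
      by (simp_all add: sat_fm_club_disagreeing[OF H])
    have C'\<beta>: "club_in (elts C') \<beta>"
      using sat C' crit(2) e(1) d\<beta>M by (simp add: sat_fm_club_disagreeing[OF M])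
    then have "unbounded_in (elts (j C')) \<beta>"
      using reflect[OF _ C'] unfolding club_in_def unbounded_in_def by blast
    moreover have "elts \<beta> \<noteq> {}"
      using small_embedding_crit_infinite[OF emb] by (auto simp: \<beta>_def)
    ultimately have "\<beta> \<in> elts (j C')"
      using club crit(3) unfolding club_in_def by blast
    moreover have "d \<beta> \<in> H \<theta>"
    proof (rule subset_of_elt_in_H[OF \<theta>])
      have "elts \<beta> \<subseteq> elts \<kappa>"
        using ordinal_trans[OF ordinal_elt[OF cardinal_ordinal[OF \<theta>(1)] \<theta>(2)] crit(3)] by blast
      then show "elts (d \<beta>) \<subseteq> elts \<kappa>"
        using d\<beta> by blast
    qed
    ultimately show False
      using disagree[of \<beta> "d \<beta>"] agree crit(3) by (simp add: kpair_in_seq_iff)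
  qed
  then show "stationary_in {\<alpha> \<in> elts \<kappa>. elts (d \<alpha>) = elts D \<inter> elts \<alpha>} \<kappa>"
    unfolding stationary_in_def by blast
qed

theorem lemma5p5:
  fixes \<kappa> :: "'v::zfc_universe"
  assumes "cardinal \<kappa>"
  shows "ineffable \<kappa> \<longleftrightarrow>
    (\<exists>\<alpha>. ordinal \<alpha> \<and> elts \<kappa> \<subseteq> elts \<alpha> \<and>
      (\<forall>\<theta>. cardinal \<theta> \<and> \<alpha> \<in> elts \<theta> \<longrightarrow>
        (\<forall>d. list_on \<kappa> d \<longrightarrow>
          (\<exists>M j. small_embedding \<kappa> \<theta> M j \<and>
                 seq \<kappa> d \<in> j ` elts M \<and>
                 d (crit j (elts M)) \<in> elts M))))"
    (is "_ \<longleftrightarrow> (\<exists>\<alpha>. ordinal \<alpha> \<and> elts \<kappa> \<subseteq> elts \<alpha> \<and> ?embeddings \<alpha>)")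
proof -
  have ord: "ordinal \<kappa>"
    using assms by (rule cardinal_ordinal)
  obtain \<alpha>\<^sub>0 where \<alpha>\<^sub>0: "ordinal \<alpha>\<^sub>0" "\<kappa> \<in> elts \<alpha>\<^sub>0"
    and seq: "\<And>\<theta> \<gamma> f. cardinal \<theta> \<Longrightarrow> \<alpha>\<^sub>0 \<in> elts \<theta> \<Longrightarrow> elts \<gamma> \<subseteq> elts \<kappa> \<Longrightarrow>
      (\<And>\<xi>. \<xi> \<in> elts \<gamma> \<Longrightarrow> elts (f \<xi>) \<subseteq> elts \<kappa>) \<Longrightarrow> seq \<gamma> f \<in> H \<theta>"
    using ex_cardinal_seq_in_H[OF ord] by metis
  have sub\<kappa>: "elts \<xi> \<subseteq> elts \<kappa>" if "\<xi> \<in> elts \<kappa>" for \<xi>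
    using ordinal_trans[OF ord that] by blast
  have seq_list: "seq \<kappa> d \<in> H \<theta>" if "cardinal \<theta>" "\<alpha>\<^sub>0 \<in> elts \<theta>" "list_on \<kappa> d" for \<theta> d
    using that sub\<kappa> by (intro seq) (auto simp: list_on_def)
  show ?thesis
  proof (intro iffI)
    assume ineff: "ineffable \<kappa>"
    have "\<kappa> \<in> elts \<theta>" if "cardinal \<theta>" "\<alpha>\<^sub>0 \<in> elts \<theta>" for \<theta>
      using ordinal_trans[OF cardinal_ordinal[OF that(1)] that(2) \<alpha>\<^sub>0(2)] .
    then have "?embeddings \<alpha>\<^sub>0"
      using ineffable_imp_small_embedding[OF ineff] seq_list by blast
    moreover have "elts \<kappa> \<subseteq> elts \<alpha>\<^sub>0"
      using ordinal_trans[OF \<alpha>\<^sub>0] by blast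
    ultimately show "\<exists>\<alpha>. ordinal \<alpha> \<and> elts \<kappa> \<subseteq> elts \<alpha> \<and> ?embeddings \<alpha>"
      using \<alpha>\<^sub>0(1) by blast
  next
    assume "\<exists>\<alpha>. ordinal \<alpha> \<and> elts \<kappa> \<subseteq> elts \<alpha> \<and> ?embeddings \<alpha>"
    then obtain \<alpha> where \<alpha>: "ordinal \<alpha>" and emb: "?embeddings \<alpha>"
      by blast
    \<comment> \<open>\<open>\<theta>\<close> must also be large enough for \<open>H(\<theta>)\<close> to contain the maps that witness singularity.\<close>
    obtain \<theta> :: 'v where \<theta>: "cardinal \<theta>" "elts (set_of (elts \<alpha> \<union> elts \<alpha>\<^sub>0)) \<prec> elts \<theta>"
      using ex_cardinal_gt[of "set_of (elts \<alpha> \<union> elts \<alpha>\<^sub>0)"] by (elim exE conjE)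
    have union: "elts (set_of (elts \<alpha> \<union> elts \<alpha>\<^sub>0)) = elts \<alpha> \<union> elts \<alpha>\<^sub>0"
      by (simp add: small_Un)
    have above: "\<mu> \<in> elts \<theta>" if "ordinal \<mu>" "elts \<mu> \<subseteq> elts \<alpha> \<union> elts \<alpha>\<^sub>0" for \<mu>
      using lesspoll_trans1[OF subset_imp_lepoll[OF that(2)] \<theta>(2)[unfolded union]]
      by (rule lesspoll_imp_mem[OF that(1) cardinal_ordinal[OF \<theta>(1)]])
    have \<theta>_above: "\<alpha> \<in> elts \<theta>" "\<alpha>\<^sub>0 \<in> elts \<theta>"
      using \<alpha> \<alpha>\<^sub>0(1) by (auto intro!: above)
    have embeddings: "\<exists>M j. small_embedding \<kappa> \<theta> M j \<and> seq \<kappa> d \<in> j ` elts M \<and>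
        d (crit j (elts M)) \<in> elts M" if "list_on \<kappa> d" for d
      using emb \<theta>(1) \<theta>_above(1) that by blast
    \<comment> \<open>Regularity and uncountability follow from a single small embedding, for whichever list.\<close>
    have "list_on \<kappa> (\<lambda>\<alpha>. \<alpha>)"
      by (simp add: list_on_def)
    then obtain M j where Mj: "small_embedding \<kappa> \<theta> M j"
      using embeddings by blast
    have "regular \<kappa>"
    proof (rule small_embedding_imp_regular[OF Mj])
      fix \<gamma> f
      assume "\<gamma> \<in> elts \<kappa>" "f ` elts \<gamma> \<subseteq> elts \<kappa>"
      then show "seq \<gamma> f \<in> H \<theta>"
        using sub\<kappa> by (intro seq \<theta>(1) \<theta>_above(2)) auto
    qed
    moreover have "uncountable (elts \<kappa>)"
      using Mj by (rule small_embedding_imp_uncountable)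
    moreover have "\<exists>D. elts D \<subseteq> elts \<kappa> \<and>
        stationary_in {\<alpha> \<in> elts \<kappa>. elts (d \<alpha>) = elts D \<inter> elts \<alpha>} \<kappa>" if d: "list_on \<kappa> d" for d
    proof -
      obtain M j where "small_embedding \<kappa> \<theta> M j" "seq \<kappa> d \<in> j ` elts M"
        "d (crit j (elts M)) \<in> elts M"
        using embeddings[OF d] by blast
      then show ?thesis
        using small_embedding_imp_stationary[OF _ d] by blast
    qed
    ultimately show "ineffable \<kappa>"
      unfolding ineffable_def by blast
  qed
qed

end
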